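(* For every $\varepsilon>0$ there exists a bounded linear operator $T_\varepsilon:\ell_2\to\ell_2$ such that for every polynomial $P$ (with complex coefficients) $$\|P(T_\varepsilon)\|\le (1+\varepsilon)\,\|P\|_\infty ,$$ but $T_\varepsilon$ is not similar to a contraction, i.e. there does not exist an invertible bounded operator $S:\ell_2\to\ell_2$ such that $\|S^{-1}T_\varepsilon S\|\le 1$.
   Context: All spaces are complex; $\ell_2$ is the usual separable infinite dimensional Hilbert space. For a polynomial $P$, $\|P\|_\infty=\sup\{|P(z)| : z\in\mathbb{C},\ |z|=1\}$. *)

theory Defs
  imports "HOL-Analysis.Analysis" "HOL-Computational_Algebra.Polynomial"
begin

typedef ell2 = "{x :: nat \<Rightarrow> complex. summable (\<lambda>n. (cmod (x n))\<^sup>2)}"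
  morphisms coord Abs_ell2
  by (rule exI[of _ "\<lambda>_. 0"]) simp

setup_lifting type_definition_ell2

lemma square_sum_add_le:
  fixes x y :: "nat \<Rightarrow> complex"
  assumes x: "summable (\<lambda>n. (cmod (x n))\<^sup>2)" and y: "summable (\<lambda>n. (cmod (y n))\<^sup>2)"
  shows "(\<Sum>n<N. (cmod (x n + y n))\<^sup>2) \<le>
    (sqrt (\<Sum>n. (cmod (x n))\<^sup>2) + sqrt (\<Sum>n. (cmod (y n))\<^sup>2))\<^sup>2"
proof -
  have part: "L2_set (\<lambda>n. cmod (z n)) {..<N} \<le> sqrt (\<Sum>n. (cmod (z n))\<^sup>2)"
    if "summable (\<lambda>n. (cmod (z n))\<^sup>2)" for z :: "nat \<Rightarrow> complex"
    unfolding L2_set_def by (intro real_sqrt_le_mono sum_le_suminf that) auto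
  have "L2_set (\<lambda>n. cmod (x n + y n)) {..<N} \<le> L2_set (\<lambda>n. cmod (x n) + cmod (y n)) {..<N}"
    by (intro L2_set_mono norm_triangle_ineq) auto
  also have "\<dots> \<le> L2_set (\<lambda>n. cmod (x n)) {..<N} + L2_set (\<lambda>n. cmod (y n)) {..<N}"
    by (rule L2_set_triangle_ineq)
  also have "\<dots> \<le> sqrt (\<Sum>n. (cmod (x n))\<^sup>2) + sqrt (\<Sum>n. (cmod (y n))\<^sup>2)"
    by (intro add_mono part x y)
  finally have "L2_set (\<lambda>n. cmod (x n + y n)) {..<N} \<le>
    sqrt (\<Sum>n. (cmod (x n))\<^sup>2) + sqrt (\<Sum>n. (cmod (y n))\<^sup>2)" .
  then have "(L2_set (\<lambda>n. cmod (x n + y n)) {..<N})\<^sup>2 \<le>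
    (sqrt (\<Sum>n. (cmod (x n))\<^sup>2) + sqrt (\<Sum>n. (cmod (y n))\<^sup>2))\<^sup>2"
    by (intro power_mono) auto
  then show ?thesis
    by (simp add: L2_set_def sum_nonneg)
qed

lemma square_summable_add:
  fixes x y :: "nat \<Rightarrow> complex"
  assumes "summable (\<lambda>n. (cmod (x n))\<^sup>2)" and "summable (\<lambda>n. (cmod (y n))\<^sup>2)"
  shows "summable (\<lambda>n. (cmod (x n + y n))\<^sup>2)"
  by (rule summableI_nonneg_bounded[OF _ square_sum_add_le[OF assms]]) simp

lemma square_summable_scale:
  fixes x :: "nat \<Rightarrow> complex"
  assumes "summable (\<lambda>n. (cmod (x n))\<^sup>2)"
  shows "summable (\<lambda>n. (cmod (c * x n))\<^sup>2)"
  using assms by (simp add: norm_mult power_mult_distrib summable_mult)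

lift_definition scale_ell2 :: "complex \<Rightarrow> ell2 \<Rightarrow> ell2" (infixr "*\<^sub>C" 75)
  is "\<lambda>c x n. c * x n"
  by (rule square_summable_scale)

instantiation ell2 :: real_normed_vector
begin

lift_definition zero_ell2 :: ell2 is "\<lambda>_. 0" by simp

lift_definition plus_ell2 :: "ell2 \<Rightarrow> ell2 \<Rightarrow> ell2" is "\<lambda>x y n. x n + y n"
  by (rule square_summable_add)

lift_definition uminus_ell2 :: "ell2 \<Rightarrow> ell2" is "\<lambda>x n. - x n" by simp

lift_definition minus_ell2 :: "ell2 \<Rightarrow> ell2 \<Rightarrow> ell2" is "\<lambda>x y n. x n - y n"
  using square_summable_add[of _ "\<lambda>n. - y n" for y] by simp

definition scaleR_ell2 :: "real \<Rightarrow> ell2 \<Rightarrow> ell2" where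
  "scaleR_ell2 r x = complex_of_real r *\<^sub>C x"

lift_definition norm_ell2 :: "ell2 \<Rightarrow> real" is "\<lambda>x. sqrt (\<Sum>n. (cmod (x n))\<^sup>2)" .

definition sgn_ell2 :: "ell2 \<Rightarrow> ell2" where
  "sgn_ell2 x = inverse (norm x) *\<^sub>R x"

definition dist_ell2 :: "ell2 \<Rightarrow> ell2 \<Rightarrow> real" where
  "dist_ell2 x y = norm (x - y)"

definition uniformity_ell2 :: "(ell2 \<times> ell2) filter" where
  "uniformity_ell2 = (INF e\<in>{0<..}. principal {(x, y). dist x y < e})"

definition open_ell2 :: "ell2 set \<Rightarrow> bool" where
  "open_ell2 U \<longleftrightarrow> (\<forall>x\<in>U. eventually (\<lambda>(x', y). x' = x \<longrightarrow> y \<in> U) uniformity)"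

instance
proof
  fix x y z :: ell2 and a b :: real
  show "x + y + z = x + (y + z)" by transfer (simp add: algebra_simps)
  show "x + y = y + x" by transfer (simp add: algebra_simps)
  show "0 + x = x" by transfer simp
  show "- x + x = 0" by transfer simp
  show "x - y = x + - y" by transfer simp
  show "a *\<^sub>R (x + y) = a *\<^sub>R x + a *\<^sub>R y"
    unfolding scaleR_ell2_def by transfer (simp add: algebra_simps)
  show "(a + b) *\<^sub>R x = a *\<^sub>R x + b *\<^sub>R x"
    unfolding scaleR_ell2_def by transfer (simp add: algebra_simps)
  show "a *\<^sub>R b *\<^sub>R x = (a * b) *\<^sub>R x"
    unfolding scaleR_ell2_def by transfer (simp add: algebra_simps)
  show "1 *\<^sub>R x = x"
    unfolding scaleR_ell2_def by transfer simp
  show "dist x y = norm (x - y)" by (rule dist_ell2_def)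
  show "sgn x = inverse (norm x) *\<^sub>R x" by (rule sgn_ell2_def)
  show "(uniformity :: (ell2 \<times> ell2) filter) = (INF e\<in>{0<..}. principal {(x, y). dist x y < e})"
    by (rule uniformity_ell2_def)
  show "open U \<longleftrightarrow> (\<forall>x\<in>U. eventually (\<lambda>(x', y). x' = x \<longrightarrow> y \<in> U) uniformity)" for U :: "ell2 set"
    by (rule open_ell2_def)
  show "norm x = 0 \<longleftrightarrow> x = 0"
    by transfer (auto simp: suminf_eq_zero_iff)
  show "norm (x + y) \<le> norm x + norm y"
  proof transfer
    fix x y :: "nat \<Rightarrow> complex"
    assume xy: "summable (\<lambda>n. (cmod (x n))\<^sup>2)" "summable (\<lambda>n. (cmod (y n))\<^sup>2)"
    have "(\<Sum>n. (cmod (x n + y n))\<^sup>2) \<le>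
        (sqrt (\<Sum>n. (cmod (x n))\<^sup>2) + sqrt (\<Sum>n. (cmod (y n))\<^sup>2))\<^sup>2"
      by (intro suminf_le_const square_summable_add square_sum_add_le xy)
    then show "sqrt (\<Sum>n. (cmod (x n + y n))\<^sup>2) \<le>
        sqrt (\<Sum>n. (cmod (x n))\<^sup>2) + sqrt (\<Sum>n. (cmod (y n))\<^sup>2)"
      by (intro real_le_lsqrt add_nonneg_nonneg real_sqrt_ge_zero suminf_nonneg xy) auto
  qed
  show "norm (a *\<^sub>R x) = \<bar>a\<bar> * norm x"
    unfolding scaleR_ell2_def
    by transfer (simp add: norm_mult power_mult_distrib suminf_mult real_sqrt_mult)
qed

end

text \<open>The library predicate bounded_linear is only real-linear, so complex homogeneity is required
  separately. The library norm onorm is the operator norm on such maps; on an unbounded map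
  its value would be meaningless, but it is applied below only to bounded operators.\<close>

definition bounded_operator :: "(ell2 \<Rightarrow> ell2) \<Rightarrow> bool" where
  "bounded_operator T \<longleftrightarrow> bounded_linear T \<and> (\<forall>c x. T (c *\<^sub>C x) = c *\<^sub>C T x)"

definition invertible_operator :: "(ell2 \<Rightarrow> ell2) \<Rightarrow> bool" where
  "invertible_operator S \<longleftrightarrow> bounded_operator S \<and> bij S \<and> bounded_operator (inv S)"

definition poly_operator :: "complex poly \<Rightarrow> (ell2 \<Rightarrow> ell2) \<Rightarrow> ell2 \<Rightarrow> ell2" where
  "poly_operator P T x = (\<Sum>i\<le>degree P. coeff P i *\<^sub>C (T ^^ i) x)"

definition poly_sup_norm :: "complex poly \<Rightarrow> real" where
  "poly_sup_norm P = (SUP z\<in>{z. cmod z = 1}. cmod (poly P z))"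

definition similar_to_contraction :: "(ell2 \<Rightarrow> ell2) \<Rightarrow> bool" where
  "similar_to_contraction T \<longleftrightarrow> (\<exists>S. invertible_operator S \<and> onorm (inv S \<circ> T \<circ> S) \<le> 1)"

end

(*
Foguel-Hankel operators (Pisier), with estimates after Davidson and Paulsen. A block is
T(u,v) = (S^* u + G v, S v) on two copies of l2(C^d), where S is a nilpotent shift of size N and G is the
Hankel matrix (beta_{i+j} w_{i+j}) with anticommuting symmetric unitaries w_k. Then S^* G = G S, so the
corner of P(T) is the Hankel matrix G P'(S).

Upper bound. For a Hankel matrix with entries in a Hilbert space E, acting from scalars to E, the norm of the
corner is O(delta |P|) because p' x = (p x)' - p x' and the tails of beta_k^2 are at most delta^2/(n+1)^2.
Parrott's theorem extends this matrix to negative indices, so its Fejer means give a bounded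
E-valued symbol; mapping the basis vector e_k of E to w_k costs only a factor sqrt 2.

Lower bound. If T is similar to a contraction by S, the matrix polynomial sum_k a_k w_k z^(k+1) has
norm at most |S| |S^-1| sqrt (2 sum a_k^2) at T, while its value on the vector sum_A e_A (x) (0, e_0 (x) e_A)
shows that it is at least sum_k (k+1) a_k beta_k. With a_k = (k+1) beta_k the sum of a_k^2 diverges with N like
the harmonic series, so the direct sum of the blocks over all N is not similar to a contraction.
*)

theory Submission
  imports Defs
begin

text \<open>A contraction satisfies von Neumann's inequality for matrix polynomials of every size,
  so similarity to a contraction bounds all of these by one constant, whereas the required estimate
  concerns scalar polynomials only. Anticommuting symmetries expose the gap: the matrix
  \<open>\<Sum>k. f k w k\<close> has norm at most sqrt 2 times the l2 norm of \<open>f\<close>, but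
  in \<open>\<Sum>k. f k (w k \<otimes> w k)\<close> nonnegative coefficients add up without
  cancellation. The weights are borderline: \<open>beta \<delta> k\<close> has order k^(-3/2), small
  enough to pay for one derivative and too large for the squares of
  \<open>(k + 1) * beta \<delta> k\<close> to be summable. A single block is a nilpotent matrix and
  hence similar to a contraction; only the cost of the similarity grows with N. So infinitely many
  blocks are needed, with a polynomial bound uniform in N. Finite blocks keep the estimates finite:
  values at roots of unity stand in for boundary values, and positivity along finite orbits stands
  in for dilation theory.\<close>

subsection \<open>Parseval on roots of unity and multiplier estimates\<close>

lemma sum_root_unity_powers:
  fixes R n m :: nat
  assumes "n < R" "m < R"
  defines "\<omega> \<equiv> \<lambda>r::nat. cis (2 * pi * real r / real R)"
  shows "(\<Sum>r<R. \<omega> r ^ n * cnj (\<omega> r ^ m)) = (if n = m then of_nat R else 0)"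
proof -
  have R: "R > 0" using assms by simp
  \<comment> \<open>Exchanging base and exponent turns the sum over \<open>r\<close> into a
    geometric series with ratio \<open>\<zeta>\<close>.\<close>
  have pw: "\<omega> r ^ k = \<omega> k ^ r" for r k
    unfolding \<omega>_def Complex.DeMoivre by (rule arg_cong[of _ _ cis]) (simp add: mult_ac)
  define \<zeta> where "\<zeta> = \<omega> n * cnj (\<omega> m)"
  have one: "\<omega> k * cnj (\<omega> k) = 1" for k
    by (simp add: \<omega>_def cis_mult cis_cnj)
  have eq: "(\<Sum>r<R. \<omega> r ^ n * cnj (\<omega> r ^ m)) = (\<Sum>r<R. \<zeta> ^ r)"
  proof (intro sum.cong refl)
    fix r
    show "\<omega> r ^ n * cnj (\<omega> r ^ m) = \<zeta> ^ r"
      unfolding pw[of r n] pw[of r m] \<zeta>_def by (simp add: power_mult_distrib)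
  qed
  have \<omega>R: "\<omega> k ^ R = 1" for k
  proof -
    have "real R * (2 * pi * real k / real R) = 2 * pi * real k" using R by simp
    then show ?thesis 
      unfolding \<omega>_def Complex.DeMoivre by (simp add: cis_multiple_2pi)
  qed
  have \<zeta>R: "\<zeta> ^ R = 1"
    unfolding \<zeta>_def power_mult_distrib using \<omega>R[of n] arg_cong[OF \<omega>R[of m], of cnj] by simp
  show ?thesis
  proof (cases "n = m")
    case True
    then have "\<zeta> = 1" using one by (simp add: \<zeta>_def)
    then show ?thesis unfolding eq using True by simp
  next
    case False
    have "\<zeta> \<noteq> 1"
    proof
      assume "\<zeta> = 1"
      have "\<omega> n = \<omega> n * (\<omega> m * cnj (\<omega> m))" unfolding one by simp
      also have "\<dots> = \<zeta> * \<omega> m" by (simp add: \<zeta>_def)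
      finally have "\<omega> n = \<omega> m" unfolding \<open>\<zeta> = 1\<close> by simp
      moreover have "inj_on \<omega> {..<R}"
        using Complex.bij_betw_roots_unity[OF R] by (simp add: \<omega>_def bij_betw_def)
      ultimately show False using False assms(1,2) by (auto dest: inj_onD)
    qed
    then show ?thesis unfolding eq using False \<zeta>R
      by (simp add: geometric_sum)
  qed
qed

text \<open>With more sample points than coefficients there is no aliasing, so the discrete identity
  is exact and replaces integration over the circle.\<close>

lemma parseval_roots_of_unity:
  fixes p :: "complex poly"
  assumes deg: "degree p < R"
  shows "(\<Sum>r<R. (cmod (poly p (cis (2 * pi * real r / real R))))\<^sup>2) =
    real R * (\<Sum>n<R. (cmod (coeff p n))\<^sup>2)"
proof -
  define \<omega> where "\<omega> = (\<lambda>r::nat. cis (2 * pi * real r / real R))"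
  have p: "poly p z = (\<Sum>n<R. coeff p n * z ^ n)" for z
    unfolding poly_altdef
    by (rule sum.mono_neutral_left) (use deg in \<open>auto simp: coeff_eq_0\<close>)
  have "complex_of_real (\<Sum>r<R. (cmod (poly p (\<omega> r)))\<^sup>2) =
    (\<Sum>r<R. (\<Sum>n<R. \<Sum>m<R. coeff p n * cnj (coeff p m) * (\<omega> r ^ n * cnj (\<omega> r ^ m))))"
    unfolding of_real_sum complex_norm_square p cnj_sum sum_product
    by (intro sum.cong refl) (simp add: mult_ac)
  also have "\<dots> = (\<Sum>n<R. \<Sum>m<R. coeff p n * cnj (coeff p m) * (\<Sum>r<R. \<omega> r ^ n * cnj (\<omega> r ^ m)))"
    unfolding sum_distrib_left
    by (rule trans[OF sum.swap]) (rule sum.cong[OF refl], rule sum.swap)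
  also have "\<dots> = (\<Sum>n<R. \<Sum>m<R. coeff p n * cnj (coeff p m) * (if n = m then of_nat R else 0))"
    unfolding \<omega>_def by (intro sum.cong refl arg_cong2[of _ _ _ _ times] sum_root_unity_powers) auto
  also have "\<dots> = complex_of_real (real R * (\<Sum>n<R. (cmod (coeff p n))\<^sup>2))"
    unfolding of_real_mult of_real_sum complex_norm_square
    by (simp add: sum_distrib_left mult_ac if_distrib cong: if_cong)
  finally show ?thesis unfolding \<omega>_def of_real_eq_iff .
qed

lemma cmod_poly_le_sup_norm:
  assumes "cmod z = 1"
  shows "cmod (poly P z) \<le> poly_sup_norm P"
proof -
  have "compact ((\<lambda>z. cmod (poly P z)) ` sphere 0 1)"
    by (intro compact_continuous_image continuous_intros compact_sphere)
  then have "bdd_above ((\<lambda>z. cmod (poly P z)) ` {z. cmod z = 1})"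
    by (auto simp: sphere_def dist_norm dest!: compact_imp_bounded bounded_imp_bdd_above)
  then show ?thesis
    unfolding poly_sup_norm_def by (rule cSUP_upper2) (use assms in auto)
qed

lemma poly_sup_norm_nonneg: "0 \<le> poly_sup_norm P"
  using cmod_poly_le_sup_norm[of 1 P] norm_ge_zero[of "poly P 1"]
  by (metis norm_one order_trans)

lemma coeff_sum_monom:
  "coeff (\<Sum>j<N. monom (x j) j) n = (if n < N then x n else 0)"
  by (simp add: coeff_sum sum.delta)

text \<open>Coefficients of \<open>X\<close> from \<open>K\<close> on do not influence the first
  \<open>K\<close> coefficients of \<open>p * X\<close>, so \<open>X\<close> may be truncated and
  Parseval applied. Having this for every prefix \<open>K\<close> is what admits decreasing weights
  later.\<close>

lemma sum_coeff_mult_le: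
  fixes p X :: "complex poly"
  shows "(\<Sum>n<K. (cmod (coeff (p * X) n))\<^sup>2) \<le>
    (poly_sup_norm p)\<^sup>2 * (\<Sum>n<K. (cmod (coeff X n))\<^sup>2)"
proof -
  define Y where "Y = (\<Sum>j<K. monom (coeff X j) j)"
  have Yc: "coeff Y n = (if n < K then coeff X n else 0)" for n
    unfolding Y_def by (rule coeff_sum_monom)
  have pY: "coeff (p * Y) n = coeff (p * X) n" if "n < K" for n
    unfolding coeff_mult using that by (intro sum.cong refl) (auto simp: Yc)
  define R where "R = Suc (degree (p * Y) + degree Y + K)"
  have R: "R > 0" "degree (p * Y) < R" "degree Y < R" "K \<le> R" by (auto simp: R_def)
  define z where "z = (\<lambda>r::nat. cis (2 * pi * real r / real R))"
  have "real R * (\<Sum>n<K. (cmod (coeff (p * X) n))\<^sup>2) = real R * (\<Sum>n<K. (cmod (coeff (p * Y) n))\<^sup>2)"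
    by (simp add: pY)
  also have "\<dots> \<le> real R * (\<Sum>n<R. (cmod (coeff (p * Y) n))\<^sup>2)"
    using R by (intro mult_left_mono sum_mono2) auto
  also have "\<dots> = (\<Sum>r<R. (cmod (poly (p * Y) (z r)))\<^sup>2)"
    unfolding z_def using parseval_roots_of_unity[OF R(2)] by simp
  also have "\<dots> \<le> (\<Sum>r<R. (poly_sup_norm p)\<^sup>2 * (cmod (poly Y (z r)))\<^sup>2)"
    unfolding poly_mult norm_mult power_mult_distrib
    by (intro sum_mono mult_right_mono power_mono cmod_poly_le_sup_norm) (auto simp: z_def)
  also have "\<dots> = (poly_sup_norm p)\<^sup>2 * (real R * (\<Sum>n<R. (cmod (coeff Y n))\<^sup>2))"
    unfolding sum_distrib_left[symmetric] z_def using parseval_roots_of_unity[OF R(3)] by simp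
  also have "(\<Sum>n<R. (cmod (coeff Y n))\<^sup>2) = (\<Sum>n<K. (cmod (coeff Y n))\<^sup>2)"
    using R by (intro sum.mono_neutral_right) (auto simp: Yc)
  also have "\<dots> = (\<Sum>n<K. (cmod (coeff X n))\<^sup>2)"
    by (simp add: Yc)
  finally have "real R * (\<Sum>n<K. (cmod (coeff (p * X) n))\<^sup>2) \<le>
      real R * ((poly_sup_norm p)\<^sup>2 * (\<Sum>n<K. (cmod (coeff X n))\<^sup>2))"
    by (simp add: mult_ac)
  then show ?thesis using R by simp
qed

text \<open>Abel summation: the difference of the two sides is a combination of the differences of
  prefix sums with the nonnegative coefficients \<open>w n - w (Suc n)\<close> and a last
  \<open>w\<close>.\<close>

lemma sum_decreasing_weights_mono:
  fixes a b w :: "nat \<Rightarrow> real"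
  assumes prefix: "\<And>K. (\<Sum>n<K. a n) \<le> (\<Sum>n<K. b n)"
    and dec: "\<And>n. w (Suc n) \<le> w n" and nonneg: "\<And>n. 0 \<le> w n"
  shows "(\<Sum>n<K. w n * a n) \<le> (\<Sum>n<K. w n * b n)"
proof -
  have "w K * (\<Sum>n<K. b n - a n) \<le> (\<Sum>n<K. w n * (b n - a n))" for K
  proof (induction K)
    case (Suc K)
    have "w (Suc K) * (\<Sum>n<Suc K. b n - a n) \<le> w K * (\<Sum>n<Suc K. b n - a n)"
      using prefix[of "Suc K"] by (intro mult_right_mono dec) (simp add: sum_subtractf)
    also have "\<dots> \<le> (\<Sum>n<Suc K. w n * (b n - a n))"
      using Suc by (simp add: distrib_left)
    finally show ?case .
  qed simp
  moreover have "0 \<le> w K * (\<Sum>n<K. b n - a n)"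
    using prefix[of K] nonneg[of K] by (simp add: sum_subtractf)
  ultimately have "0 \<le> (\<Sum>n<K. w n * (b n - a n))"
    by (rule order_trans[rotated])
  then show ?thesis by (simp add: right_diff_distrib sum_subtractf)
qed

lemma cmod_diff_square_le: "(cmod (a - b))\<^sup>2 \<le> 2 * (cmod a)\<^sup>2 + 2 * (cmod b)\<^sup>2"
proof -
  have "(cmod (a - b))\<^sup>2 \<le> (cmod a + cmod b)\<^sup>2"
    by (intro power_mono norm_triangle_ineq4) auto
  also have "\<dots> \<le> 2 * (cmod a)\<^sup>2 + 2 * (cmod b)\<^sup>2"
    using zero_le_power2[of "cmod a - cmod b"] by (simp add: power2_sum power2_diff)
  finally show ?thesis .
qed

text \<open>The key point is \<open>p' X = (p X)' - p X'\<close>: the weight \<open>1/(n+1)\<^sup>2\<close> undoes one derivative in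
  each term, and multiplication by \<open>p\<close> is bounded for any decreasing weight.\<close>

lemma sum_coeff_pderiv_mult_le:
  fixes p X :: "complex poly"
  assumes deg: "\<And>n. n \<ge> N \<Longrightarrow> coeff X n = 0"
  shows "(\<Sum>n<N. (cmod (coeff (pderiv p * X) n))\<^sup>2 / (real n + 1)\<^sup>2) \<le>
    4 * (poly_sup_norm p)\<^sup>2 * (\<Sum>n<N. (cmod (coeff X n))\<^sup>2)"
proof -
  let ?S = "(poly_sup_norm p)\<^sup>2 * (\<Sum>n<N. (cmod (coeff X n))\<^sup>2)"
  have e: "pderiv p * X = pderiv (p * X) - p * pderiv X"
    by (simp add: pderiv_mult algebra_simps)
  have cd: "(cmod (coeff (pderiv Y) n))\<^sup>2 / (real n + 1)\<^sup>2 = (cmod (coeff Y (Suc n)))\<^sup>2" for Y :: "complex poly" and n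
  proof -
    have "cmod (coeff (pderiv Y) n) = (real n + 1) * cmod (coeff Y (Suc n))"
      unfolding coeff_pderiv norm_mult norm_of_nat by simp
    moreover have "(real n + 1)\<^sup>2 \<noteq> 0" by (simp add: power2_eq_square add_nonneg_eq_0_iff)
    ultimately show ?thesis by (simp add: power_mult_distrib)
  qed
  have Suc_le: "(\<Sum>n<N. (cmod (coeff Y (Suc n)))\<^sup>2) \<le> (\<Sum>n<Suc N. (cmod (coeff Y n))\<^sup>2)" for Y :: "complex poly"
    unfolding sum.lessThan_Suc_shift by simp
  have X: "(\<Sum>n<Suc N. (cmod (coeff X n))\<^sup>2) = (\<Sum>n<N. (cmod (coeff X n))\<^sup>2)"
    using deg[of N] by simp
  have 1: "(\<Sum>n<N. (cmod (coeff (pderiv (p * X)) n))\<^sup>2 / (real n + 1)\<^sup>2) \<le> ?S"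
  proof -
    have "(\<Sum>n<N. (cmod (coeff (p * X) (Suc n)))\<^sup>2) \<le> (\<Sum>n<Suc N. (cmod (coeff (p * X) n))\<^sup>2)"
      by (rule Suc_le)
    also have "\<dots> \<le> (poly_sup_norm p)\<^sup>2 * (\<Sum>n<Suc N. (cmod (coeff X n))\<^sup>2)"
      by (rule sum_coeff_mult_le)
    finally show ?thesis unfolding cd X .
  qed
  have 2: "(\<Sum>n<N. (cmod (coeff (p * pderiv X) n))\<^sup>2 / (real n + 1)\<^sup>2) \<le> ?S"
  proof -
    have "(\<Sum>n<N. inverse ((real n + 1)\<^sup>2) * (cmod (coeff (p * pderiv X) n))\<^sup>2) \<le>
        (\<Sum>n<N. inverse ((real n + 1)\<^sup>2) * ((poly_sup_norm p)\<^sup>2 * (cmod (coeff (pderiv X) n))\<^sup>2))"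
    proof (rule sum_decreasing_weights_mono)
      fix n
      show "inverse ((real (Suc n) + 1)\<^sup>2) \<le> inverse ((real n + 1)\<^sup>2)"
        by (intro le_imp_inverse_le power_mono zero_less_power) auto
    qed (use sum_coeff_mult_le in \<open>auto simp: sum_distrib_left\<close>)
    also have "\<dots> = (poly_sup_norm p)\<^sup>2 * (\<Sum>n<N. (cmod (coeff (pderiv X) n))\<^sup>2 / (real n + 1)\<^sup>2)"
      by (simp add: sum_distrib_left divide_inverse mult_ac)
    also have "\<dots> \<le> ?S"
      unfolding cd using Suc_le[of X] X by (intro mult_left_mono) auto
    finally show ?thesis by (simp add: divide_inverse mult_ac)
  qed
  \<comment> \<open>Splitting the square of the difference costs a factor 2 for each of the two
    terms, hence the constant 4.\<close>
  have "(\<Sum>n<N. (cmod (coeff (pderiv p * X) n))\<^sup>2 / (real n + 1)\<^sup>2) \<le>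
    (\<Sum>n<N. 2 * ((cmod (coeff (pderiv (p * X)) n))\<^sup>2 / (real n + 1)\<^sup>2) +
      2 * ((cmod (coeff (p * pderiv X) n))\<^sup>2 / (real n + 1)\<^sup>2))"
    unfolding e coeff_diff times_divide_eq_right add_divide_distrib[symmetric]
    by (intro sum_mono divide_right_mono cmod_diff_square_le) simp
  also have "\<dots> \<le> 2 * ?S + 2 * ?S"
    unfolding sum.distrib sum_distrib_left[symmetric] by (intro add_mono mult_left_mono 1 2) auto
  finally show ?thesis by simp
qed

subsection \<open>Anticommuting symmetries\<close>

text \<open>Entrywise form of the Clifford relations w_k w_l + w_l w_k = 2 [k = l] for symmetric
  matrices; the case k = l says that each w_k is unitary. Real entries let the matrices act by
  \<open>scaleR\<close> on vectors of any real space and pass through a real bilinear form.\<close>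

definition anticommuting :: "nat \<Rightarrow> nat \<Rightarrow> (nat \<Rightarrow> nat \<Rightarrow> nat \<Rightarrow> real) \<Rightarrow> bool" where
  "anticommuting K d w \<longleftrightarrow>
    (\<forall>k<K. \<forall>A<d. \<forall>B<d. w k A B = w k B A) \<and>
    (\<forall>k<K. \<forall>l<K. \<forall>A<d. \<forall>C<d.
      (\<Sum>B<d. w k A B * w l B C + w l A B * w k B C) = (if k = l \<and> A = C then 2 else 0))"

lemma anticommuting_sym:
  "anticommuting K d w \<Longrightarrow> k < K \<Longrightarrow> A < d \<Longrightarrow> B < d \<Longrightarrow> w k A B = w k B A"
  unfolding anticommuting_def by blast

lemma anticommuting_sum:
  assumes "anticommuting K d w" "k < K" "l < K" "B < d" "C < d"
  shows "(\<Sum>A<d. w k A B * w l A C + w l A B * w k A C) = (if k = l \<and> B = C then 2 else 0)"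
proof -
  have "(\<Sum>A<d. w k A B * w l A C + w l A B * w k A C) = (\<Sum>A<d. w k B A * w l A C + w l B A * w k A C)"
    using assms(2-5) by (intro sum.cong refl) (simp add: anticommuting_sym[OF assms(1)])
  also have "\<dots> = (if k = l \<and> B = C then 2 else 0)"
    using assms(1)[unfolded anticommuting_def, THEN conjunct2, rule_format, OF assms(2-5)] .
  finally show ?thesis .
qed

lemma anticommuting_square:
  assumes "anticommuting K d w" "k < K" "A < d"
  shows "(\<Sum>B<d. w k A B * w k A B) = 1"
proof -
  have "(\<Sum>B<d. w k B A * w k B A + w k B A * w k B A) = 2"
    using anticommuting_sum[OF assms(1,2,2,3,3)] by simp
  moreover have "(\<Sum>B<d. w k B A * w k B A) = (\<Sum>B<d. w k A B * w k A B)"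
    using assms by (intro sum.cong refl) (simp add: anticommuting_sym)
  ultimately show ?thesis unfolding sum.distrib by linarith
qed

text \<open>The Jordan-Wigner representation on the space with orthonormal basis \<open>Pow {..<K}\<close>: \<open>w k\<close> flips
  membership of \<open>k\<close>, with a sign counting the smaller members.\<close>

lemma anticommuting_exists: "\<exists>d w. 0 < d \<and> anticommuting K d w"
proof -
  define t :: "nat \<Rightarrow> nat set \<Rightarrow> nat set" where "t k A = (if k \<in> A then A - {k} else insert k A)" for k A
  define s :: "nat \<Rightarrow> nat set \<Rightarrow> real" where "s k A = (- 1) ^ card (A \<inter> {..<k})" for k A
  define w0 where "w0 k A B = (if B = t k A then s k A else 0)" for k A B
  let ?P = "Pow {..<K}"
  have t_in: "t k A \<in> ?P" if "k < K" "A \<in> ?P" for k A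
    using that by (auto simp: t_def)
  have tt: "t k (t k A) = A" for k A by (auto simp: t_def)
  have t_comm: "t k (t l A) = t l (t k A)" for k l A by (auto simp: t_def)
  have t_eq: "B = t k A \<longleftrightarrow> A = t k B" for A B k using tt by metis
  have s_same: "s k (t k A) = s k A" for k A
    unfolding s_def t_def by (rule arg_cong[of _ _ "\<lambda>X. (-1) ^ card X"]) auto
  have s_above: "s k (t l A) = s k A" if "k < l" for k l A
    unfolding s_def t_def using that by (intro arg_cong[of _ _ "\<lambda>X. (-1) ^ card X"]) auto
  have s_below: "s l (t k A) = - s l A" if "k < l" for k l A
  proof (cases "k \<in> A")
    case True
    have "A \<inter> {..<l} = insert k ((A - {k}) \<inter> {..<l})" using True that by auto
    then have "card (A \<inter> {..<l}) = Suc (card ((A - {k}) \<inter> {..<l}))"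
      by (metis card_insert_disjoint finite_Int finite_lessThan Int_iff Diff_iff singletonI)
    then show ?thesis using True by (simp add: s_def t_def)
  next
    case False
    have "insert k A \<inter> {..<l} = insert k (A \<inter> {..<l})" using that by auto
    then have "card (insert k A \<inter> {..<l}) = Suc (card (A \<inter> {..<l}))"
      using False by simp
    then show ?thesis using False by (simp add: s_def t_def)
  qed
  have s_sq: "s k A * s k A = 1" for k A
    by (simp add: s_def flip: power_add)
  have prod: "(\<Sum>B\<in>?P. w0 k A B * w0 l B C) = (if C = t l (t k A) then s k A * s l (t k A) else 0)"
    if "k < K" "A \<in> ?P" for k l A C
    unfolding w0_def using t_in[OF that] by (simp add: if_distrib[of "\<lambda>x. x * _"] cong: if_cong)
  \<comment> \<open>For distinct indices, flipping the smaller one changes the parity counted by the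
    larger one and not conversely, so the two orders carry opposite signs.\<close>
  have anti: "s k A * s l (t k A) + s l A * s k (t l A) = (if k = l then 2 else 0)" for k l A
  proof (cases k l rule: linorder_cases)
    case less
    then show ?thesis by (simp add: s_above s_below)
  next
    case equal
    then show ?thesis by (simp add: s_same s_sq)
  next
    case greater
    then show ?thesis by (simp add: s_above s_below)
  qed
  have "finite ?P" by simp
  then obtain f where f: "bij_betw f {0..<card ?P} ?P"
    using ex_bij_betw_nat_finite by blast
  define d where "d = card ?P"
  define w where "w k a b = w0 k (f a) (f b)" for k a b
  have f': "bij_betw f {..<d} ?P" using f by (simp add: d_def lessThan_atLeast0)
  have "anticommuting K d w"
    unfolding anticommuting_def
  proof (intro conjI allI impI)
    fix k A B assume "k < K" "A < d" "B < d"
    show "w k A B = w k B A"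
      unfolding w_def w0_def using t_eq s_same by auto
  next
    fix k l A C assume kl: "k < K" "l < K" "A < d" "C < d"
    have fA: "f A \<in> ?P" using f' kl by (auto dest: bij_betwE)
    have inj: "f A = f C \<longleftrightarrow> A = C"
      using f' kl by (auto simp: bij_betw_def dest: inj_onD)
    have "(\<Sum>B<d. w k A B * w l B C + w l A B * w k B C) =
      (\<Sum>B\<in>?P. w0 k (f A) B * w0 l B (f C) + w0 l (f A) B * w0 k B (f C))"
      unfolding w_def by (rule sum.reindex_bij_betw[OF f'])
    also have "\<dots> = (if f C = t l (t k (f A)) then s k (f A) * s l (t k (f A)) + s l (f A) * s k (t l (f A)) else 0)"
      unfolding sum.distrib prod[OF kl(1) fA] prod[OF kl(2) fA] by (simp add: t_comm[of k l])
    also have "\<dots> = (if k = l \<and> A = C then 2 else 0)"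
      unfolding anti using inj by (auto simp: tt)
    finally show "(\<Sum>B<d. w k A B * w l B C + w l A B * w k B C) = (if k = l \<and> A = C then 2 else 0)" .
  qed
  moreover have "0 < d" by (simp add: d_def card_Pow)
  ultimately show ?thesis by blast
qed

lemma sum_move_inside:
  "(\<Sum>x\<in>X. \<Sum>k\<in>K. \<Sum>l\<in>L. \<Sum>B\<in>M. \<Sum>C\<in>N. f x k l B C) =
   (\<Sum>k\<in>K. \<Sum>l\<in>L. \<Sum>B\<in>M. \<Sum>C\<in>N. \<Sum>x\<in>X. f x k l B C)"
  by (simp add: sum.swap[where A = X])

lemma sum_quadratic_expand:
  fixes Q :: "'v::real_vector \<Rightarrow> 'v \<Rightarrow> real" and y :: "nat \<Rightarrow> nat \<Rightarrow> 'i \<Rightarrow> 'v"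
    and w :: "nat \<Rightarrow> nat \<Rightarrow> nat \<Rightarrow> real" and K d :: nat
  assumes Q: "bilinear Q"
  defines "z \<equiv> \<lambda>A n. \<Sum>k<K. \<Sum>B<d. w k A B *\<^sub>R y k B n"
  shows "(\<Sum>n\<in>S. \<Sum>A<d. Q (z A n) (z A n)) =
    (\<Sum>k<K. \<Sum>l<K. \<Sum>B<d. \<Sum>C<d. (\<Sum>A<d. w k A B * w l A C) * (\<Sum>n\<in>S. Q (y k B n) (y l C n)))"
proof -
  have l1: "linear (\<lambda>x. Q x y)" and l2: "linear (\<lambda>y. Q x y)" for x y
    using Q by (auto simp: bilinear_def)
  have "Q (z A n) (z A n) = (\<Sum>k<K. \<Sum>l<K. \<Sum>B<d. \<Sum>C<d. w k A B * w l A C * Q (y k B n) (y l C n))" for A n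
  proof -
    have "Q (z A n) (z A n) =
      (\<Sum>k<K. \<Sum>B<d. \<Sum>l<K. \<Sum>C<d. w k A B * w l A C * Q (y k B n) (y l C n))"
      unfolding z_def unfolding linear_sum[OF l1] linear_cmul[OF l1] unfolding linear_sum[OF l2] linear_cmul[OF l2]
      by (simp add: sum_distrib_left mult_ac)
    then show ?thesis
      by (simp add: sum.swap[of _ "{..<K}" "{..<d}"])
  qed
  then have "(\<Sum>n\<in>S. \<Sum>A<d. Q (z A n) (z A n)) =
    (\<Sum>n\<in>S. \<Sum>A<d. \<Sum>k<K. \<Sum>l<K. \<Sum>B<d. \<Sum>C<d. w k A B * w l A C * Q (y k B n) (y l C n))"
    by simp
  also have "\<dots> = (\<Sum>A<d. \<Sum>n\<in>S. \<Sum>k<K. \<Sum>l<K. \<Sum>B<d. \<Sum>C<d. w k A B * w l A C * Q (y k B n) (y l C n))"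
    by (rule sum.swap)
  also have "\<dots> = (\<Sum>A<d. \<Sum>k<K. \<Sum>l<K. \<Sum>B<d. \<Sum>C<d. \<Sum>n\<in>S. w k A B * w l A C * Q (y k B n) (y l C n))"
    by (rule sum.cong[OF refl], rule sum_move_inside)
  also have "\<dots> = (\<Sum>k<K. \<Sum>l<K. \<Sum>B<d. \<Sum>C<d. \<Sum>A<d. \<Sum>n\<in>S. w k A B * w l A C * Q (y k B n) (y l C n))"
    by (rule sum_move_inside)
  finally show ?thesis
    by (simp only: sum_product)
qed

text \<open>The family \<open>y'\<close> has the Gram matrix of \<open>y\<close> with k and l
  exchanged. In the sum of the two expansions each Gram entry is therefore multiplied by an
  anticommutator, and only the diagonal survives. When \<open>Q\<close> is positive, dropping the
  \<open>z'\<close> term bounds \<open>z\<close> by twice the diagonal.\<close>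

lemma clifford_parallelogram:
  fixes Q :: "'v::real_vector \<Rightarrow> 'v \<Rightarrow> real" and y y' :: "nat \<Rightarrow> nat \<Rightarrow> 'i \<Rightarrow> 'v"
  assumes Q: "bilinear Q" and w: "anticommuting K d w"
    and swap: "\<And>k l B C. k < K \<Longrightarrow> l < K \<Longrightarrow> B < d \<Longrightarrow> C < d \<Longrightarrow>
      (\<Sum>n\<in>S. Q (y' k B n) (y' l C n)) = (\<Sum>n\<in>S. Q (y l B n) (y k C n))"
  defines "z \<equiv> \<lambda>A n. \<Sum>k<K. \<Sum>B<d. w k A B *\<^sub>R y k B n"
    and "z' \<equiv> \<lambda>A n. \<Sum>k<K. \<Sum>B<d. w k A B *\<^sub>R y' k B n"
  shows "(\<Sum>n\<in>S. \<Sum>A<d. Q (z A n) (z A n)) + (\<Sum>n\<in>S. \<Sum>A<d. Q (z' A n) (z' A n)) =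
    2 * (\<Sum>k<K. \<Sum>B<d. \<Sum>n\<in>S. Q (y k B n) (y k B n))"
proof -
  define G where "G k l B C = (\<Sum>n\<in>S. Q (y k B n) (y l C n))" for k l B C
  have 1: "(\<Sum>n\<in>S. \<Sum>A<d. Q (z A n) (z A n)) =
    (\<Sum>k<K. \<Sum>l<K. \<Sum>B<d. \<Sum>C<d. (\<Sum>A<d. w k A B * w l A C) * G k l B C)"
    unfolding z_def sum_quadratic_expand[OF Q] G_def ..
  have "(\<Sum>n\<in>S. \<Sum>A<d. Q (z' A n) (z' A n)) =
    (\<Sum>k<K. \<Sum>l<K. \<Sum>B<d. \<Sum>C<d. (\<Sum>A<d. w k A B * w l A C) * G l k B C)"
    unfolding z'_def sum_quadratic_expand[OF Q] G_def by (intro sum.cong refl) (simp add: swap)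
  also have "\<dots> = (\<Sum>k<K. \<Sum>l<K. \<Sum>B<d. \<Sum>C<d. (\<Sum>A<d. w l A B * w k A C) * G k l B C)"
    by (rule sum.swap)
  finally have 2: "(\<Sum>n\<in>S. \<Sum>A<d. Q (z' A n) (z' A n)) = \<dots>" .
  have "(\<Sum>n\<in>S. \<Sum>A<d. Q (z A n) (z A n)) + (\<Sum>n\<in>S. \<Sum>A<d. Q (z' A n) (z' A n)) =
    (\<Sum>k<K. \<Sum>l<K. \<Sum>B<d. \<Sum>C<d. (\<Sum>A<d. w k A B * w l A C + w l A B * w k A C) * G k l B C)"
    unfolding 1 2 by (simp add: sum.distrib distrib_right)
  also have "\<dots> = (\<Sum>k<K. \<Sum>l<K. \<Sum>B<d. \<Sum>C<d. if k = l then if B = C then 2 * G k l B C else 0 else 0)"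
    by (intro sum.cong refl) (simp add: anticommuting_sum[OF w])
  also have "\<dots> = (\<Sum>k<K. \<Sum>l<K. if k = l then (\<Sum>B<d. 2 * G k l B B) else 0)"
    by (intro sum.cong refl) (auto simp: sum.delta)
  also have "\<dots> = 2 * (\<Sum>k<K. \<Sum>B<d. G k k B B)"
    by (simp add: sum.delta sum_distrib_left)
  finally show ?thesis unfolding G_def .
qed

text \<open>For real coefficients the cross terms cancel by themselves; for complex ones they cancel
  only against those of the conjugate coefficients, and discarding that second sum costs the factor
  2.\<close>

lemma clifford_combination_le:
  fixes f y :: "nat \<Rightarrow> complex"
  assumes w: "anticommuting K d w"
  shows "(\<Sum>A<d. (cmod (\<Sum>k<K. \<Sum>B<d. of_real (w k A B) * (f k * y B)))\<^sup>2) \<le>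
    2 * (\<Sum>k<K. (cmod (f k))\<^sup>2) * (\<Sum>B<d. (cmod (y B))\<^sup>2)"
proof -
  define g where "g k B (n::unit) = f k * y B" for k B n
  \<comment> \<open>Conjugating the scalar exchanges k and l in the real inner product; the index of
    type \<open>unit\<close> makes the sum over \<open>S\<close> a single term.\<close>
  define g' where "g' k B (n::unit) = cnj (f k) * y B" for k B n
  have "bilinear (inner :: complex \<Rightarrow> _)"
    using bounded_bilinear_inner bilinear_conv_bounded_bilinear by blast
  moreover have "(\<Sum>n\<in>{()}. inner (g' k B n) (g' l C n)) = (\<Sum>n\<in>{()}. inner (g l B n) (g k C n))" for k l B C
    by (simp add: g_def g'_def inner_complex_def algebra_simps)
  ultimately have "(\<Sum>n\<in>{()}. \<Sum>A<d. inner (\<Sum>k<K. \<Sum>B<d. w k A B *\<^sub>R g k B n) (\<Sum>k<K. \<Sum>B<d. w k A B *\<^sub>R g k B n)) +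
    (\<Sum>n\<in>{()}. \<Sum>A<d. inner (\<Sum>k<K. \<Sum>B<d. w k A B *\<^sub>R g' k B n) (\<Sum>k<K. \<Sum>B<d. w k A B *\<^sub>R g' k B n)) =
    2 * (\<Sum>k<K. \<Sum>B<d. \<Sum>n\<in>{()}. inner (g k B n) (g k B n))"
    by (intro clifford_parallelogram[OF _ w]) auto
  moreover have "(\<Sum>n\<in>{()}. \<Sum>A<d. inner (\<Sum>k<K. \<Sum>B<d. w k A B *\<^sub>R g' k B n) (\<Sum>k<K. \<Sum>B<d. w k A B *\<^sub>R g' k B n)) \<ge> 0"
    by (intro sum_nonneg) simp
  ultimately show ?thesis
    by (simp add: g_def dot_square_norm norm_mult power_mult_distrib scaleR_conv_of_real sum_product mult_ac)
qed

subsection \<open>Extension of column Hankel matrices\<close>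

text \<open>\<open>M\<close> bounds the squared norm of the R x R Hankel matrix whose entry at (i,
  j) is the column \<open>c (i + j)\<close> in C^K, as an operator from C^R to C^R \<otimes>
  C^K.\<close>

definition hankel_le :: "(nat \<Rightarrow> nat \<Rightarrow> complex) \<Rightarrow> nat \<Rightarrow> nat \<Rightarrow> real \<Rightarrow> bool" where
  "hankel_le c K R M \<longleftrightarrow> (\<forall>x::nat \<Rightarrow> complex.
    (\<Sum>i<R. \<Sum>k<K. (cmod (\<Sum>j<R. c (i + j) k * x j))\<^sup>2) \<le> M * (\<Sum>j<R. (cmod (x j))\<^sup>2))"

lemma hankel_leD:
  "hankel_le c K R M \<Longrightarrow>
    (\<Sum>i<R. \<Sum>k<K. (cmod (\<Sum>j<R. c (i + j) k * x j))\<^sup>2) \<le> M * (\<Sum>j<R. (cmod (x j))\<^sup>2)"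
  unfolding hankel_le_def by blast

lemma hankel_le_mono: "hankel_le c K R M \<Longrightarrow> M \<le> M' \<Longrightarrow> hankel_le c K R M'"
  unfolding hankel_le_def by (meson mult_right_mono order_trans sum_nonneg zero_le_power2)

lemma cmod_square_convex_combination:
  "(cmod (complex_of_real (1 - s) * a + complex_of_real s * b))\<^sup>2 =
    (1 - s) * (cmod a)\<^sup>2 + s * (cmod b)\<^sup>2 - s * (1 - s) * (cmod (b - a))\<^sup>2"
  unfolding cmod_power2 by (simp add: power2_eq_square algebra_simps)

text \<open>One step of Parrott's extension theorem. The new entry is \<open>- r a\<close>, where \<open>a\<close> nearly minimises the
  slack \<open>\<phi>\<close> of the part of the inequality that does not involve the new entry.\<close>

lemma hankel_extend_one:
  assumes le: "hankel_le c K R M" and zero: "\<And>n k. n \<ge> R \<Longrightarrow> c n k = 0"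
    and M: "0 \<le> M" "M < M'"
  shows "\<exists>v. hankel_le (case_nat v c) K (Suc R) M'"
proof -
  \<comment> \<open>For the enlarged matrix applied to (x0, x): \<open>r x\<close> is the
    contribution of the known entries to the top row, and \<open>B x0 x\<close> is the squared norm
    of the other rows, which do not see the new entry. \<open>\<phi>\<close> is the slack of these
    rows at x0 = 1 and \<open>Q\<close> its quadratic part.\<close>
  define N2 :: "(nat \<Rightarrow> complex) \<Rightarrow> real" where "N2 x = (\<Sum>j<R. (cmod (x j))\<^sup>2)" for x
  define r where "r x k = (\<Sum>j<R. c j k * x j)" for x k
  define b where "b x i k = (\<Sum>j<R. c (Suc (i + j)) k * x j)" for x i k
  define B where "B x0 x = (\<Sum>i<R. \<Sum>k<K. (cmod (c i k * x0 + b x i k))\<^sup>2)" for x0 x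
  define \<phi> where "\<phi> x = M * (1 + N2 x) - B 1 x" for x
  define Q where "Q h = M * N2 h - B 0 h" for h
  \<comment> \<open>Since \<open>c\<close> vanishes from index \<open>R\<close> on, the matrix of
    size \<open>R\<close> is already the whole Hankel matrix, and an additional last coordinate of
    the vector contributes nothing.\<close>
  have B_le: "B x0 x \<le> M * ((cmod x0)\<^sup>2 + N2 x)" for x0 x
  proof -
    have e: "(\<Sum>j<R. c (i + j) k * case_nat x0 x j) = c i k * x0 + b x i k" for i k
    proof -
      have "(\<Sum>j<Suc R. c (i + j) k * case_nat x0 x j) = c i k * x0 + b x i k"
        unfolding sum.lessThan_Suc_shift b_def by simp
      then show ?thesis using zero[of "i + R" k] by simp
    qed
    have "B x0 x \<le> M * (\<Sum>j<R. (cmod (case_nat x0 x j))\<^sup>2)"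
      using hankel_leD[OF le, of "case_nat x0 x"] unfolding e B_def .
    also have "\<dots> \<le> M * (\<Sum>j<Suc R. (cmod (case_nat x0 x j))\<^sup>2)"
      using M by (intro mult_left_mono) auto
    also have "\<dots> = M * ((cmod x0)\<^sup>2 + N2 x)"
      unfolding sum.lessThan_Suc_shift N2_def by simp
    finally show ?thesis .
  qed
  have \<phi>_nonneg: "0 \<le> \<phi> x" for x
    using B_le[of 1 x] by (simp add: \<phi>_def)
  have r_le: "(\<Sum>k<K. (cmod (r h k))\<^sup>2) \<le> Q h" for h
  proof -
    have "(\<Sum>i<Suc R. \<Sum>k<K. (cmod (\<Sum>j<R. c (i + j) k * h j))\<^sup>2) \<le> M * N2 h"
      using hankel_leD[OF le, of h] by (simp add: zero N2_def)
    then show ?thesis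
      unfolding sum.lessThan_Suc_shift by (simp add: r_def b_def B_def Q_def)
  qed
  have r_diff: "r x k - r a k = r (\<lambda>j. x j - a j) k" for x a k
    by (simp add: r_def sum_subtractf algebra_simps)
  have b_comb: "b (\<lambda>j. complex_of_real (1 - s) * a j + complex_of_real s * x j) i k =
      complex_of_real (1 - s) * b a i k + complex_of_real s * b x i k" for s a x i k
    by (simp add: b_def sum.distrib sum_distrib_left algebra_simps sum_subtractf)
  have b_diff: "b x i k - b a i k = b (\<lambda>j. x j - a j) i k" for x a i k
    by (simp add: b_def sum_subtractf algebra_simps)
  have B_conv: "B 1 (\<lambda>j. complex_of_real (1 - s) * a j + complex_of_real s * x j) =
    (1 - s) * B 1 a + s * B 1 x - s * (1 - s) * B 0 (\<lambda>j. x j - a j)" for s a x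
  proof -
    have "(cmod (c i k * 1 + b (\<lambda>j. complex_of_real (1 - s) * a j + complex_of_real s * x j) i k))\<^sup>2 =
      (1 - s) * (cmod (c i k * 1 + b a i k))\<^sup>2 + s * (cmod (c i k * 1 + b x i k))\<^sup>2
        - s * (1 - s) * (cmod (c i k * 0 + b (\<lambda>j. x j - a j) i k))\<^sup>2" for i k
    proof -
      have "c i k * 1 + b (\<lambda>j. complex_of_real (1 - s) * a j + complex_of_real s * x j) i k =
        complex_of_real (1 - s) * (c i k * 1 + b a i k) + complex_of_real s * (c i k * 1 + b x i k)"
        unfolding b_comb by (simp add: algebra_simps)
      moreover have "c i k * 0 + b (\<lambda>j. x j - a j) i k = (c i k * 1 + b x i k) - (c i k * 1 + b a i k)"
        unfolding b_diff[symmetric] by simp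
      ultimately show ?thesis by (simp only: cmod_square_convex_combination)
    qed
    then show ?thesis
      unfolding B_def by (simp add: sum.distrib sum_subtractf sum_distrib_left)
  qed
  have N2_conv: "N2 (\<lambda>j. complex_of_real (1 - s) * a j + complex_of_real s * x j) =
    (1 - s) * N2 a + s * N2 x - s * (1 - s) * N2 (\<lambda>j. x j - a j)" for s a x
    unfolding N2_def cmod_square_convex_combination
    by (simp add: sum.distrib sum_subtractf sum_distrib_left)
  have \<phi>_conv: "\<phi> (\<lambda>j. complex_of_real (1 - s) * a j + complex_of_real s * x j) =
    (1 - s) * \<phi> a + s * \<phi> x - s * (1 - s) * Q (\<lambda>j. x j - a j)" for s a x
    unfolding \<phi>_def Q_def B_conv N2_conv by (simp add: algebra_simps)
  \<comment> \<open>A near-minimiser is chosen within \<open>s\<^sup>2\<close> of the infimum, and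
    this is where \<open>M\<close> has to increase to \<open>M'\<close>: the identity
    \<open>M + s = M' * (1 - s)\<close> absorbs both the factor \<open>1 - s\<close> and the error
    \<open>s\<close> of the next estimate.\<close>
  define s where "s = (M' - M) / (1 + M')"
  have s: "0 < s" "s < 1" "M + s = M' * (1 - s)"
    using M by (auto simp: s_def field_simps)
  have "Inf (range \<phi>) < Inf (range \<phi>) + s\<^sup>2" using s by simp
  then obtain a where a: "\<phi> a < Inf (range \<phi>) + s\<^sup>2"
    using cInf_lessD[of "range \<phi>"] by blast
  have "bdd_below (range \<phi>)" using \<phi>_nonneg by (auto simp: bdd_below_def)
  then have a_min: "\<phi> a - s\<^sup>2 \<le> \<phi> x" for x
    using a cInf_lower[of "\<phi> x" "range \<phi>"] by auto
  \<comment> \<open>Approximate first-order optimality: compare \<open>\<phi>\<close> at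
    \<open>a\<close> with its value a fraction \<open>s\<close> of the way from \<open>a\<close> to
    \<open>x\<close>, then divide by \<open>s\<close>.\<close>
  have \<phi>_ge: "(1 - s) * Q (\<lambda>j. x j - a j) - s \<le> \<phi> x" for x
  proof -
    have "\<phi> a - s\<^sup>2 \<le> (1 - s) * \<phi> a + s * \<phi> x - s * (1 - s) * Q (\<lambda>j. x j - a j)"
      unfolding \<phi>_conv[symmetric] by (rule a_min)
    then have "s * (\<phi> a - s) \<le> s * (\<phi> x - (1 - s) * Q (\<lambda>j. x j - a j))"
      by (simp add: algebra_simps power2_eq_square)
    then show ?thesis using s \<phi>_nonneg[of a] by simp
  qed
  define v where "v k = - r a k" for k
  define S where "S x0 x = (\<Sum>k<K. (cmod (v k * x0 + r x k))\<^sup>2) + B x0 x" for x0 x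
  have S1: "S 1 x \<le> M' * (1 + N2 x)" for x
  proof -
    have "(\<Sum>k<K. (cmod (v k * 1 + r x k))\<^sup>2) \<le> Q (\<lambda>j. x j - a j)"
      using r_le[of "\<lambda>j. x j - a j"] by (simp add: v_def r_diff[symmetric])
    then have "(1 - s) * (\<Sum>k<K. (cmod (v k * 1 + r x k))\<^sup>2) \<le> (1 - s) * Q (\<lambda>j. x j - a j)"
      using s by (intro mult_left_mono) auto
    moreover have "(1 - s) * B 1 x \<le> 1 * B 1 x"
      using s by (intro mult_right_mono) (auto simp: B_def intro!: sum_nonneg)
    ultimately have "(1 - s) * S 1 x \<le> M * (1 + N2 x) + s"
      using \<phi>_ge[of x] unfolding \<phi>_def S_def by (simp add: algebra_simps)
    also have "\<dots> \<le> (M + s) * (1 + N2 x)"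
      using s by (simp add: algebra_simps N2_def sum_nonneg)
    also have "\<dots> = (1 - s) * (M' * (1 + N2 x))"
      unfolding s by simp
    finally show ?thesis using s by simp
  qed
  have S: "S x0 x \<le> M' * ((cmod x0)\<^sup>2 + N2 x)" for x0 x
  proof (cases "x0 = 0")
    case True
    have "S x0 x \<le> M * N2 x"
      using r_le[of x] True by (simp add: S_def Q_def)
    also have "\<dots> \<le> M' * N2 x"
      using M by (intro mult_right_mono) (auto simp: N2_def sum_nonneg)
    finally show ?thesis using True by simp
  next
    case False
    define y where "y j = x j / x0" for j
    have x: "x j = x0 * y j" for j using False by (simp add: y_def)
    have 1: "r x k = x0 * r y k" "b x i k = x0 * b y i k" for i k
      unfolding r_def b_def x by (simp_all add: sum_distrib_left mult_ac)
    have "v k * x0 + r x k = x0 * (v k * 1 + r y k)"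
      "c i k * x0 + b x i k = x0 * (c i k * 1 + b y i k)" for i k
      unfolding 1 by (simp_all add: algebra_simps)
    then have "S x0 x = (cmod x0)\<^sup>2 * S 1 y"
      unfolding S_def B_def
      by (simp only: norm_mult power_mult_distrib distrib_left[of "(cmod x0)\<^sup>2"] sum_distrib_left)
    also have "\<dots> \<le> (cmod x0)\<^sup>2 * (M' * (1 + N2 y))"
      by (intro mult_left_mono S1) auto
    also have "\<dots> = M' * ((cmod x0)\<^sup>2 + N2 x)"
      unfolding N2_def x by (simp add: norm_mult power_mult_distrib sum_distrib_left algebra_simps)
    finally show ?thesis .
  qed
  have "hankel_le (case_nat v c) K (Suc R) M'"
    unfolding hankel_le_def
  proof
    fix x :: "nat \<Rightarrow> complex"
    have "(\<Sum>i<Suc R. \<Sum>k<K. (cmod (\<Sum>j<Suc R. case_nat v c (i + j) k * x j))\<^sup>2) =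
      S (x 0) (\<lambda>j. x (Suc j))"
      unfolding sum.lessThan_Suc_shift S_def B_def r_def b_def by simp
    also have "\<dots> \<le> M' * (\<Sum>j<Suc R. (cmod (x j))\<^sup>2)"
      using S[of "x 0" "\<lambda>j. x (Suc j)"] unfolding sum.lessThan_Suc_shift N2_def by simp
    finally show "(\<Sum>i<Suc R. \<Sum>k<K. (cmod (\<Sum>j<Suc R. case_nat v c (i + j) k * x j))\<^sup>2) \<le>
      M' * (\<Sum>j<Suc R. (cmod (x j))\<^sup>2)" .
  qed
  then show ?thesis by blast
qed

text \<open>Negative indices are encoded by a shift: position \<open>l\<close> of \<open>c'\<close>
  is index 0 of \<open>c\<close>. Each step needs some room, so the earlier steps are carried out
  below the midpoint of \<open>M\<close> and \<open>M'\<close>.\<close>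

lemma hankel_extend:
  assumes le: "hankel_le c K R M" and zero: "\<And>n k. n \<ge> R \<Longrightarrow> c n k = 0"
    and M: "0 \<le> M" "M < M'"
  shows "\<exists>c'. (\<forall>n. c' (l + n) = c n) \<and> hankel_le c' K (R + l) M'"
  using M(2)
proof (induction l arbitrary: M')
  case 0
  then show ?case using le by (auto intro!: exI[of _ c] hankel_le_mono[OF le])
next
  case (Suc l)
  define M'' where "M'' = (M + M') / 2"
  have M'': "M < M''" "M'' < M'" using Suc.prems by (auto simp: M''_def)
  obtain c' where c': "\<And>n. c' (l + n) = c n" "hankel_le c' K (R + l) M''"
    using Suc.IH[OF M''(1)] by blast
  have "c' n k = 0" if "n \<ge> R + l" for n k
    using c'(1)[of "n - l"] zero[of "n - l" k] that by simp
  then obtain v where "hankel_le (case_nat v c') K (Suc (R + l)) M'"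
    using hankel_extend_one[OF c'(2)] M'' M by (meson less_imp_le order.trans)
  then show ?case using c'(1) by (intro exI[of _ "case_nat v c'"]) auto
qed

text \<open>Pairing the matrix on both sides with the vector of powers of \<open>z\<close> of length
  \<open>L\<close> collects each antidiagonal with its multiplicity, which is an unnormalised Fejer
  mean. One factor \<open>L\<close> is the squared norm of that vector, the other comes from
  Cauchy-Schwarz over the rows.\<close>

lemma hankel_le_fejer:
  assumes le: "hankel_le c K Z M" and L: "L \<le> Z" and z: "cmod z = 1" and M: "0 \<le> M"
  shows "(\<Sum>k<K. (cmod (\<Sum>i<L. \<Sum>j<L. c (i + j) k * z ^ (i + j)))\<^sup>2) \<le> (real L)\<^sup>2 * M"
proof -
  define x where "x j = (if j < L then z ^ j else 0)" for j
  define Y where "Y i k = (\<Sum>j<L. c (i + j) k * z ^ j)" for i k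
  have Y: "(\<Sum>j<Z. c (i + j) k * x j) = Y i k" for i k
  proof -
    have "(\<Sum>j<Z. c (i + j) k * x j) = (\<Sum>j<L. c (i + j) k * x j)"
      using L by (intro sum.mono_neutral_right) (auto simp: x_def)
    then show ?thesis by (simp add: Y_def x_def)
  qed
  have "(\<Sum>j<Z. (cmod (x j))\<^sup>2) = (\<Sum>j<L. (cmod (x j))\<^sup>2)"
    using L by (intro sum.mono_neutral_right) (auto simp: x_def)
  then have x: "(\<Sum>j<Z. (cmod (x j))\<^sup>2) = real L"
    by (simp add: x_def norm_power z)
  have "(\<Sum>i<L. \<Sum>k<K. (cmod (Y i k))\<^sup>2) \<le> (\<Sum>i<Z. \<Sum>k<K. (cmod (Y i k))\<^sup>2)"
    using L by (intro sum_mono2) (auto intro: sum_nonneg)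
  also have "\<dots> \<le> M * real L"
    using hankel_leD[OF le, of x] unfolding Y x .
  finally have Y_le: "(\<Sum>i<L. \<Sum>k<K. (cmod (Y i k))\<^sup>2) \<le> M * real L" .
  have "(cmod (\<Sum>i<L. \<Sum>j<L. c (i + j) k * z ^ (i + j)))\<^sup>2 \<le> real L * (\<Sum>i<L. (cmod (Y i k))\<^sup>2)" for k
  proof -
    have "(\<Sum>i<L. \<Sum>j<L. c (i + j) k * z ^ (i + j)) = (\<Sum>i<L. z ^ i * Y i k)"
      by (simp add: Y_def sum_distrib_left power_add mult_ac)
    also have "cmod \<dots> \<le> (\<Sum>i<L. cmod (Y i k))"
      by (rule order_trans[OF norm_sum]) (simp add: norm_mult norm_power z)
    finally have "(cmod (\<Sum>i<L. \<Sum>j<L. c (i + j) k * z ^ (i + j)))\<^sup>2 \<le> (\<Sum>i<L. 1 * cmod (Y i k))\<^sup>2"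
      by (intro power_mono) auto
    also have "\<dots> \<le> (\<Sum>i<L. 1\<^sup>2) * (\<Sum>i<L. (cmod (Y i k))\<^sup>2)"
      by (rule Cauchy_Schwarz_ineq_sum)
    finally show ?thesis by simp
  qed
  then have "(\<Sum>k<K. (cmod (\<Sum>i<L. \<Sum>j<L. c (i + j) k * z ^ (i + j)))\<^sup>2) \<le>
    (\<Sum>k<K. real L * (\<Sum>i<L. (cmod (Y i k))\<^sup>2))"
    by (rule sum_mono)
  also have "\<dots> = real L * (\<Sum>i<L. \<Sum>k<K. (cmod (Y i k))\<^sup>2)"
    by (simp add: sum_distrib_left sum.swap[of _ "{..<K}"])
  also have "\<dots> \<le> real L * (M * real L)"
    by (intro mult_left_mono Y_le) auto
  finally show ?thesis by (simp add: power2_eq_square mult_ac)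
qed

subsection \<open>Hankel matrices in the span of anticommuting symmetries\<close>

text \<open>Exactly \<open>l + 1 - m\<close> pairs \<open>i, j \<le> l\<close> satisfy
  \<open>i + j = l + m\<close>; these are the triangular Fejer weights.\<close>

lemma coeff_antidiagonal_sum:
  fixes c :: "nat \<Rightarrow> complex"
  assumes "m \<le> l"
  shows "coeff (\<Sum>i<Suc l. \<Sum>j<Suc l. monom (c (i + j)) (i + j)) (l + m) = of_nat (Suc l - m) * c (l + m)"
proof -
  have "(\<Sum>j<Suc l. coeff (monom (c (i + j)) (i + j)) (l + m)) = (if m \<le> i then c (l + m) else 0)"
    if "i < Suc l" for i
  proof -
    have "(\<Sum>j<Suc l. coeff (monom (c (i + j)) (i + j)) (l + m)) =
      (\<Sum>j<Suc l. if j = l + m - i then c (l + m) else 0)"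
      using that by (intro sum.cong refl) auto
    also have "\<dots> = (if l + m - i < Suc l then c (l + m) else 0)"
      by (subst sum.delta) auto
    finally show ?thesis using that by auto
  qed
  then have "coeff (\<Sum>i<Suc l. \<Sum>j<Suc l. monom (c (i + j)) (i + j)) (l + m) =
      (\<Sum>i<Suc l. if m \<le> i then c (l + m) else 0)"
    unfolding coeff_sum by (intro sum.cong refl) auto
  also have "\<dots> = (\<Sum>i\<in>{m..<Suc l}. c (l + m))"
    by (intro sum.mono_neutral_cong_right) auto
  finally show ?thesis by simp
qed

text \<open>Parseval in each component turns a pointwise bound on the circle into one for
  coefficients; \<open>R\<close> exceeds all degrees and both cut-offs.\<close>

lemma sum_cmod_square_coeff_le:
  fixes G V :: "nat \<Rightarrow> complex poly"
  assumes le: "\<And>z. cmod z = 1 \<Longrightarrow>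
    (\<Sum>A<d. (cmod (poly (G A) z))\<^sup>2) \<le> C * (\<Sum>A<d. (cmod (poly (V A) z))\<^sup>2)"
    and V: "\<And>A n. n \<ge> N \<Longrightarrow> coeff (V A) n = 0"
  shows "(\<Sum>A<d. \<Sum>n<N'. (cmod (coeff (G A) n))\<^sup>2) \<le> C * (\<Sum>A<d. \<Sum>n<N. (cmod (coeff (V A) n))\<^sup>2)"
proof -
  define R where "R = Suc ((\<Sum>A<d. degree (G A) + degree (V A)) + N + N')"
  have "degree (G A) + degree (V A) \<le> (\<Sum>A<d. degree (G A) + degree (V A))" if "A < d" for A
    by (rule member_le_sum) (use that in auto)
  then have R: "degree (G A) < R" "degree (V A) < R" if "A < d" for A
    using that unfolding R_def by (auto simp: less_Suc_eq_le intro: order.trans add_leD1 add_leD2 trans_le_add1)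
  have R': "N \<le> R" "N' \<le> R" "0 < R" by (auto simp: R_def)
  define z where "z = (\<lambda>r::nat. cis (2 * pi * real r / real R))"
  have pars: "(\<Sum>r<R. \<Sum>A<d. (cmod (poly (H A) (z r)))\<^sup>2) = real R * (\<Sum>A<d. \<Sum>n<R. (cmod (coeff (H A) n))\<^sup>2)"
    if "\<And>A. A < d \<Longrightarrow> degree (H A) < R" for H
  proof -
    have "(\<Sum>r<R. \<Sum>A<d. (cmod (poly (H A) (z r)))\<^sup>2) = (\<Sum>A<d. \<Sum>r<R. (cmod (poly (H A) (z r)))\<^sup>2)"
      by (rule sum.swap)
    also have "\<dots> = (\<Sum>A<d. real R * (\<Sum>n<R. (cmod (coeff (H A) n))\<^sup>2))"
      unfolding z_def by (intro sum.cong refl parseval_roots_of_unity that) auto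
    finally show ?thesis by (simp add: sum_distrib_left)
  qed
  have "real R * (\<Sum>A<d. \<Sum>n<N'. (cmod (coeff (G A) n))\<^sup>2) \<le> real R * (\<Sum>A<d. \<Sum>n<R. (cmod (coeff (G A) n))\<^sup>2)"
    using R' by (intro mult_left_mono sum_mono sum_mono2) auto
  also have "\<dots> = (\<Sum>r<R. \<Sum>A<d. (cmod (poly (G A) (z r)))\<^sup>2)"
    using R by (intro pars[symmetric]) auto
  also have "\<dots> \<le> (\<Sum>r<R. C * (\<Sum>A<d. (cmod (poly (V A) (z r)))\<^sup>2))"
    by (intro sum_mono le) (simp add: z_def)
  also have "\<dots> = C * (real R * (\<Sum>A<d. \<Sum>n<R. (cmod (coeff (V A) n))\<^sup>2))"
    unfolding sum_distrib_left[symmetric] using R by (subst pars) auto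
  also have "(\<Sum>A<d. \<Sum>n<R. (cmod (coeff (V A) n))\<^sup>2) = (\<Sum>A<d. \<Sum>n<N. (cmod (coeff (V A) n))\<^sup>2)"
    using R' V by (intro sum.cong refl sum.mono_neutral_right) auto
  finally have "real R * (\<Sum>A<d. \<Sum>n<N'. (cmod (coeff (G A) n))\<^sup>2) \<le>
    real R * (C * (\<Sum>A<d. \<Sum>n<N. (cmod (coeff (V A) n))\<^sup>2))"
    by (simp add: mult_ac)
  then show ?thesis using R' by simp
qed

text \<open>The Fejer means of the symbol obtained by extending \<open>c\<close> to \<open>l\<close> negative indices
  have the Fourier coefficients of \<open>c\<close> up to the factors \<open>(l + 1 - n) / (l + 1)\<close>.\<close>

lemma hankel_clifford_fejer_le:
  assumes le: "hankel_le c K N M" and zero: "\<And>n k. n \<ge> N \<Longrightarrow> c n k = 0"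
    and M: "0 \<le> M" "M < M'" and w: "anticommuting K d w" and l: "2 * N \<le> l"
  shows "(\<Sum>A<d. \<Sum>a<N. (cmod (\<Sum>b<N. of_nat (Suc l - (a + b)) *
      (\<Sum>k<K. \<Sum>B<d. of_real (w k A B) * (c (a + b) k * v b B))))\<^sup>2) \<le>
    (real (Suc l))\<^sup>2 * (2 * M') * (\<Sum>B<d. \<Sum>b<N. (cmod (v b B))\<^sup>2)"
proof (cases "N = 0")
  case False
  obtain c' where c': "\<And>n. c' (l + n) = c n" "hankel_le c' K (N + l) M'"
    using hankel_extend[OF le zero M] by blast
  \<comment> \<open>Index 0 of \<open>c\<close> sits at exponent \<open>l\<close> of
    \<open>F\<close>. Reversing \<open>v\<close> in \<open>V\<close> turns the Hankel matrix into
    multiplication: exponents \<open>l + a + b\<close> and \<open>N - 1 - b\<close> meet at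
    \<open>l + N - 1 + a\<close>. The assumption \<open>2 * N \<le> l\<close> keeps
    \<open>a + b\<close> in the range where the Fejer weight is
    \<open>l + 1 - (a + b)\<close>.\<close>
  define F where "F k = (\<Sum>i<Suc l. \<Sum>j<Suc l. monom (c' (i + j) k) (i + j))" for k
  define V where "V B = (\<Sum>b<N. monom (v (N - Suc b) B) b)" for B
  define G where "G A = (\<Sum>k<K. \<Sum>B<d. smult (of_real (w k A B)) (V B * F k))" for A
  have V: "coeff (V B) n = (if n < N then v (N - Suc n) B else 0)" for B n
    unfolding V_def by (rule coeff_sum_monom)
  have F: "coeff (F k) (l + m) = of_nat (Suc l - m) * c m k" if "m \<le> l" for k m
    unfolding F_def using coeff_antidiagonal_sum[OF that, of "\<lambda>n. c' n k"] by (simp add: c')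
  have VF: "coeff (V B * F k) (l + N - 1 + a) = (\<Sum>b<N. v b B * (of_nat (Suc l - (a + b)) * c (a + b) k))"
    if a: "a < N" for B k a
  proof -
    have "coeff (V B * F k) (l + N - 1 + a) = (\<Sum>n\<le>l + N - 1 + a. coeff (V B) n * coeff (F k) (l + N - 1 + a - n))"
      by (rule coeff_mult)
    also have "\<dots> = (\<Sum>n<N. coeff (V B) n * coeff (F k) (l + N - 1 + a - n))"
      using False by (intro sum.mono_neutral_right) (auto simp: V)
    also have "\<dots> = (\<Sum>b<N. coeff (V B) (N - Suc b) * coeff (F k) (l + N - 1 + a - (N - Suc b)))"
      by (rule sum.nat_diff_reindex[symmetric])
    also have "\<dots> = (\<Sum>b<N. v b B * (of_nat (Suc l - (a + b)) * c (a + b) k))"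
    proof (intro sum.cong refl)
      fix b assume b: "b \<in> {..<N}"
      then have "l + N - 1 + a - (N - Suc b) = l + (a + b)" "a + b \<le> l" "N - Suc (N - Suc b) = b" "N - Suc b < N"
        using a l by auto
      then show "coeff (V B) (N - Suc b) * coeff (F k) (l + N - 1 + a - (N - Suc b)) =
          v b B * (of_nat (Suc l - (a + b)) * c (a + b) k)"
        by (simp only: F V if_True)
    qed
    finally show ?thesis .
  qed
  have G: "coeff (G A) (l + N - 1 + a) = (\<Sum>b<N. of_nat (Suc l - (a + b)) *
      (\<Sum>k<K. \<Sum>B<d. of_real (w k A B) * (c (a + b) k * v b B)))" if "a < N" for a A
  proof -
    have "coeff (G A) (l + N - 1 + a) = (\<Sum>k<K. \<Sum>B<d. \<Sum>b<N.
        of_nat (Suc l - (a + b)) * (of_real (w k A B) * (c (a + b) k * v b B)))"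
      unfolding G_def coeff_sum coeff_smult VF[OF that] by (simp add: sum_distrib_left mult_ac)
    also have "\<dots> = (\<Sum>b<N. \<Sum>k<K. \<Sum>B<d.
        of_nat (Suc l - (a + b)) * (of_real (w k A B) * (c (a + b) k * v b B)))"
      by (simp only: sum.swap[of _ "{..<N}"])
    finally show ?thesis by (simp only: sum_distrib_left)
  qed
  have E: "(\<Sum>A<d. \<Sum>a<N. (cmod (\<Sum>b<N. of_nat (Suc l - (a + b)) *
      (\<Sum>k<K. \<Sum>B<d. of_real (w k A B) * (c (a + b) k * v b B))))\<^sup>2) =
    (\<Sum>A<d. \<Sum>a<N. (cmod (coeff (G A) (l + N - 1 + a)))\<^sup>2)"
    by (intro sum.cong refl) (simp only: G lessThan_iff)
  have "(\<Sum>A<d. \<Sum>a<N. (cmod (coeff (G A) (l + N - 1 + a)))\<^sup>2) \<le>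
    (\<Sum>A<d. \<Sum>n<l + N + N. (cmod (coeff (G A) n))\<^sup>2)"
  proof (rule sum_mono)
    fix A
    have "(\<Sum>a<N. (cmod (coeff (G A) (l + N - 1 + a)))\<^sup>2) =
      (\<Sum>n\<in>(\<lambda>a. l + N - 1 + a) ` {..<N}. (cmod (coeff (G A) n))\<^sup>2)"
      by (subst sum.reindex) (auto simp: inj_on_def)
    also have "\<dots> \<le> (\<Sum>n<l + N + N. (cmod (coeff (G A) n))\<^sup>2)"
      by (intro sum_mono2) auto
    finally show "(\<Sum>a<N. (cmod (coeff (G A) (l + N - 1 + a)))\<^sup>2) \<le> \<dots>" .
  qed
  also have "\<dots> \<le> (real (Suc l))\<^sup>2 * (2 * M') * (\<Sum>B<d. \<Sum>n<N. (cmod (coeff (V B) n))\<^sup>2)"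
  proof (rule sum_cmod_square_coeff_le)
    fix z :: complex assume z: "cmod z = 1"
    have "(\<Sum>A<d. (cmod (poly (G A) z))\<^sup>2) =
      (\<Sum>A<d. (cmod (\<Sum>k<K. \<Sum>B<d. of_real (w k A B) * (poly (F k) z * poly (V B) z)))\<^sup>2)"
      by (simp add: G_def poly_sum mult_ac)
    also have "\<dots> \<le> 2 * (\<Sum>k<K. (cmod (poly (F k) z))\<^sup>2) * (\<Sum>B<d. (cmod (poly (V B) z))\<^sup>2)"
      by (rule clifford_combination_le[OF w])
    also have "\<dots> \<le> 2 * ((real (Suc l))\<^sup>2 * M') * (\<Sum>B<d. (cmod (poly (V B) z))\<^sup>2)"
    proof (intro mult_right_mono mult_left_mono)
      have "poly (F k) z = (\<Sum>i<Suc l. \<Sum>j<Suc l. c' (i + j) k * z ^ (i + j))" for k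
        unfolding F_def poly_sum poly_monom ..
      \<comment> \<open>The vector of powers has length \<open>Suc l\<close>, which fits into size
        \<open>N + l\<close> because \<open>N\<close> is positive.\<close>
      then show "(\<Sum>k<K. (cmod (poly (F k) z))\<^sup>2) \<le> (real (Suc l))\<^sup>2 * M'"
        using hankel_le_fejer[OF c'(2) _ z, of "Suc l"] False M by simp
    qed (auto intro: sum_nonneg)
    finally show "(\<Sum>A<d. (cmod (poly (G A) z))\<^sup>2) \<le>
      (real (Suc l))\<^sup>2 * (2 * M') * (\<Sum>A<d. (cmod (poly (V A) z))\<^sup>2)"
      by (simp add: mult_ac)
  qed (simp add: V)
  also have "(\<Sum>B<d. \<Sum>n<N. (cmod (coeff (V B) n))\<^sup>2) = (\<Sum>B<d. \<Sum>b<N. (cmod (v b B))\<^sup>2)"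
  proof (rule sum.cong[OF refl])
    fix B
    have "(\<Sum>n<N. (cmod (coeff (V B) n))\<^sup>2) = (\<Sum>n<N. (cmod (v (N - Suc n) B))\<^sup>2)"
      by (simp add: V)
    also have "\<dots> = (\<Sum>b<N. (cmod (v b B))\<^sup>2)"
      by (rule sum.nat_diff_reindex)
    finally show "(\<Sum>n<N. (cmod (coeff (V B) n))\<^sup>2) = \<dots>" .
  qed
  finally show ?thesis unfolding E .
qed simp

text \<open>The loss in the extension is tied to \<open>l\<close> by taking
  \<open>M' = M + 1 / (l + 1)\<close>, so that it disappears in the same limit in which the Fejer
  factors tend to 1.\<close>

lemma hankel_clifford_le:
  assumes le: "hankel_le c K N M" and zero: "\<And>n k. n \<ge> N \<Longrightarrow> c n k = 0"
    and M: "0 \<le> M" and w: "anticommuting K d w"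
  shows "(\<Sum>A<d. \<Sum>a<N. (cmod (\<Sum>b<N. \<Sum>k<K. \<Sum>B<d. of_real (w k A B) * (c (a + b) k * v b B)))\<^sup>2) \<le>
    2 * M * (\<Sum>B<d. \<Sum>b<N. (cmod (v b B))\<^sup>2)"
proof (rule LIMSEQ_le)
  define H where "H A a b = (\<Sum>k<K. \<Sum>B<d. of_real (w k A B) * (c (a + b) k * v b B))" for A a b
  define r where "r l n = of_nat (Suc l - n) / (of_nat (Suc l) :: complex)" for l n :: nat
  have r: "(\<lambda>l. r l n) \<longlonglongrightarrow> 1" for n
  proof -
    have "(\<lambda>l. 1 - of_nat n * inverse (of_nat (Suc l)) :: complex) \<longlonglongrightarrow> 1 - of_nat n * 0"
      by (intro tendsto_intros LIMSEQ_inverse_real_of_nat)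
        (rule filterlim_compose[OF lim_inverse_n filterlim_Suc])
    moreover have "\<forall>\<^sub>F l in sequentially. r l n = 1 - of_nat n * inverse (of_nat (Suc l))"
      using eventually_ge_at_top[of n]
    proof eventually_elim
      fix l assume "n \<le> l"
      then have "(of_nat (Suc l - n) :: complex) = of_nat (Suc l) - of_nat n"
        by (intro of_nat_diff) simp
      then show "r l n = 1 - of_nat n * inverse (of_nat (Suc l))"
        unfolding r_def by (simp add: field_simps del: of_nat_Suc)
    qed
    ultimately show ?thesis by (simp add: tendsto_cong)
  qed
  show "(\<lambda>l. \<Sum>A<d. \<Sum>a<N. (cmod (\<Sum>b<N. r l (a + b) * H A a b))\<^sup>2) \<longlonglongrightarrow>
    (\<Sum>A<d. \<Sum>a<N. (cmod (\<Sum>b<N. H A a b))\<^sup>2)"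
    by (intro tendsto_sum tendsto_power tendsto_norm) (use tendsto_mult[OF r tendsto_const] in auto)
  let ?V = "\<Sum>B<d. \<Sum>b<N. (cmod (v b B))\<^sup>2"
  have "(\<lambda>l. 2 * (M + inverse (real (Suc l))) * ?V) \<longlonglongrightarrow> 2 * (M + 0) * ?V"
    by (intro tendsto_intros LIMSEQ_inverse_real_of_nat)
  then show "(\<lambda>l. 2 * (M + inverse (real (Suc l))) * ?V) \<longlonglongrightarrow> 2 * M * ?V" by simp
  show "\<exists>n. \<forall>l\<ge>n. (\<Sum>A<d. \<Sum>a<N. (cmod (\<Sum>b<N. r l (a + b) * H A a b))\<^sup>2) \<le>
    2 * (M + inverse (real (Suc l))) * ?V"
  proof (intro exI allI impI)
    fix l assume l: "2 * N \<le> l"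
    have eq: "(\<Sum>b<N. r l (a + b) * H A a b) =
        (\<Sum>b<N. of_nat (Suc l - (a + b)) * H A a b) / of_nat (Suc l)" for A a
      by (simp add: r_def sum_divide_distrib)
    have "(\<Sum>A<d. \<Sum>a<N. (cmod (\<Sum>b<N. r l (a + b) * H A a b))\<^sup>2) =
      (\<Sum>A<d. \<Sum>a<N. (cmod (\<Sum>b<N. of_nat (Suc l - (a + b)) * H A a b))\<^sup>2) / (real (Suc l))\<^sup>2"
      by (simp only: eq norm_divide power_divide norm_of_nat flip: sum_divide_distrib)
    also have "\<dots> \<le> (real (Suc l))\<^sup>2 * (2 * (M + inverse (real (Suc l)))) * ?V / (real (Suc l))\<^sup>2"
      unfolding H_def using M l
      by (intro divide_right_mono hankel_clifford_fejer_le[OF le zero _ _ w]) auto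
    also have "\<dots> = 2 * (M + inverse (real (Suc l))) * ?V"
      by simp
    finally show "(\<Sum>A<d. \<Sum>a<N. (cmod (\<Sum>b<N. r l (a + b) * H A a b))\<^sup>2) \<le> \<dots>" .
  qed
qed

subsection \<open>Foguel-Hankel blocks\<close>

text \<open>The squares telescope: summed from n on, they give exactly \<delta>^2 / (n +
  1)^2.\<close>

definition beta :: "real \<Rightarrow> nat \<Rightarrow> real" where
  "beta \<delta> k = \<delta> * sqrt (1 / (real k + 1)\<^sup>2 - 1 / (real k + 2)\<^sup>2)"

lemma beta_square: "(beta \<delta> k)\<^sup>2 = \<delta>\<^sup>2 * (1 / (real k + 1)\<^sup>2 - 1 / (real (Suc k) + 1)\<^sup>2)"
proof -
  have "1 / (real k + 2)\<^sup>2 \<le> 1 / (real k + 1)\<^sup>2"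
    by (intro divide_left_mono power_mono mult_pos_pos zero_less_power) auto
  then show ?thesis by (simp add: beta_def power_mult_distrib add.commute)
qed

lemma sum_beta_square_le: "n \<le> N \<Longrightarrow> (\<Sum>k\<in>{n..<N}. (beta \<delta> k)\<^sup>2) \<le> \<delta>\<^sup>2 / (real n + 1)\<^sup>2"
proof -
  assume "n \<le> N"
  then have "(\<Sum>k\<in>{n..<N}. 1 / (real k + 1)\<^sup>2 - 1 / (real (Suc k) + 1)\<^sup>2) =
      1 / (real n + 1)\<^sup>2 - 1 / (real N + 1)\<^sup>2"
    by (induction rule: dec_induct) simp_all
  then have "(\<Sum>k\<in>{n..<N}. (beta \<delta> k)\<^sup>2) = \<delta>\<^sup>2 * (1 / (real n + 1)\<^sup>2 - 1 / (real N + 1)\<^sup>2)"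
    unfolding beta_square sum_distrib_left[symmetric] by simp
  also have "\<dots> \<le> \<delta>\<^sup>2 * (1 / (real n + 1)\<^sup>2)"
    by (intro mult_left_mono) auto
  finally show ?thesis by simp
qed

text \<open>The \<open>k\<close>-th coordinate of the column Hankel operator \<open>\<Gamma> p'(S)\<close>, where \<open>\<Gamma>\<close> has symbol \<open>\<Sum>k. \<beta>\<^sub>k e\<^sub>k z\<^sup>k\<close>.\<close>

definition derivative_symbol :: "real \<Rightarrow> nat \<Rightarrow> complex poly \<Rightarrow> nat \<Rightarrow> nat \<Rightarrow> complex" where
  "derivative_symbol \<delta> N p r k =
    (if r \<le> k \<and> k < N then of_real (beta \<delta> k) * coeff (pderiv p) (k - r) else 0)"

text \<open>The coordinates in C^K are orthogonal, so row i contributes the squares of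
  \<open>beta \<delta> k * y (k - i)\<close>, where \<open>y\<close> lists the coefficients of p' X.
  Collected by n = k - i, \<open>y n\<close> receives the tail of the squared weights from n on,
  which is the weight of \<open>sum_coeff_pderiv_mult_le\<close>.\<close>

lemma hankel_le_derivative_symbol:
  "hankel_le (derivative_symbol \<delta> N p) N N (4 * \<delta>\<^sup>2 * (poly_sup_norm p)\<^sup>2)"
  unfolding hankel_le_def
proof
  fix x :: "nat \<Rightarrow> complex"
  define X where "X = (\<Sum>j<N. monom (x j) j)"
  have X: "coeff X n = (if n < N then x n else 0)" for n
    unfolding X_def by (rule coeff_sum_monom)
  define y where "y = coeff (pderiv p * X)"
  have row: "(\<Sum>j<N. derivative_symbol \<delta> N p (i + j) k * x j) =
      (if i \<le> k then of_real (beta \<delta> k) * y (k - i) else 0)" if k: "k < N" for i k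
  proof (cases "i \<le> k")
    case True
    have "y (k - i) = (\<Sum>j\<le>k - i. coeff X j * coeff (pderiv p) (k - i - j))"
      unfolding y_def by (subst mult.commute) (rule coeff_mult)
    then have "of_real (beta \<delta> k) * y (k - i) =
        (\<Sum>j\<le>k - i. derivative_symbol \<delta> N p (i + j) k * x j)"
      unfolding sum_distrib_left using True k
      by (auto simp: sum_distrib_left derivative_symbol_def X mult_ac intro!: sum.cong)
    also have "\<dots> = (\<Sum>j<N. derivative_symbol \<delta> N p (i + j) k * x j)"
      using True k by (intro sum.mono_neutral_left) (auto simp: derivative_symbol_def)
    finally show ?thesis using True by simp
  qed (auto simp: derivative_symbol_def intro!: sum.neutral)
  have col: "(\<Sum>i<N. (cmod (\<Sum>j<N. derivative_symbol \<delta> N p (i + j) k * x j))\<^sup>2) =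
      (\<Sum>n\<le>k. (beta \<delta> k)\<^sup>2 * (cmod (y n))\<^sup>2)" if k: "k < N" for k
  proof -
    have "(\<Sum>i<N. (cmod (\<Sum>j<N. derivative_symbol \<delta> N p (i + j) k * x j))\<^sup>2) =
        (\<Sum>i\<le>k. (beta \<delta> k)\<^sup>2 * (cmod (y (k - i)))\<^sup>2)"
      unfolding row[OF k] using k
      by (intro sum.mono_neutral_cong_right) (auto simp: norm_mult power_mult_distrib)
    also have "\<dots> = (\<Sum>n\<le>k. (beta \<delta> k)\<^sup>2 * (cmod (y n))\<^sup>2)"
      using sum.nat_diff_reindex[of "\<lambda>n. (beta \<delta> k)\<^sup>2 * (cmod (y n))\<^sup>2" "Suc k"]
      by (simp add: lessThan_Suc_atMost)
    finally show ?thesis .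
  qed
  have "(\<Sum>i<N. \<Sum>k<N. (cmod (\<Sum>j<N. derivative_symbol \<delta> N p (i + j) k * x j))\<^sup>2) =
      (\<Sum>k<N. \<Sum>n\<le>k. (beta \<delta> k)\<^sup>2 * (cmod (y n))\<^sup>2)"
    by (subst sum.swap) (simp add: col)
  also have "\<dots> = (\<Sum>k<N. \<Sum>n<N. if n \<le> k then (beta \<delta> k)\<^sup>2 * (cmod (y n))\<^sup>2 else 0)"
    by (intro sum.cong refl sum.mono_neutral_cong_left) auto
  also have "\<dots> = (\<Sum>n<N. \<Sum>k<N. if n \<le> k then (beta \<delta> k)\<^sup>2 * (cmod (y n))\<^sup>2 else 0)"
    by (rule sum.swap)
  also have "\<dots> = (\<Sum>n<N. (\<Sum>k\<in>{n..<N}. (beta \<delta> k)\<^sup>2) * (cmod (y n))\<^sup>2)"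
    unfolding sum_distrib_right
    by (intro sum.cong refl sum.mono_neutral_cong_right) auto
  also have "\<dots> \<le> (\<Sum>n<N. (\<delta>\<^sup>2 / (real n + 1)\<^sup>2) * (cmod (y n))\<^sup>2)"
    by (intro sum_mono mult_right_mono sum_beta_square_le) auto
  also have "\<dots> = \<delta>\<^sup>2 * (\<Sum>n<N. (cmod (y n))\<^sup>2 / (real n + 1)\<^sup>2)"
    by (simp add: sum_distrib_left)
  also have "\<dots> \<le> \<delta>\<^sup>2 * (4 * (poly_sup_norm p)\<^sup>2 * (\<Sum>n<N. (cmod (coeff X n))\<^sup>2))"
    unfolding y_def by (intro mult_left_mono sum_coeff_pderiv_mult_le) (auto simp: X)
  also have "\<dots> = 4 * \<delta>\<^sup>2 * (poly_sup_norm p)\<^sup>2 * (\<Sum>n<N. (cmod (x n))\<^sup>2)"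
    by (simp add: X)
  finally show "(\<Sum>i<N. \<Sum>k<N. (cmod (\<Sum>j<N. derivative_symbol \<delta> N p (i + j) k * x j))\<^sup>2) \<le> \<dots>" .
qed

text \<open>The block \<open>(u, v) \<mapsto> (S\<^sup>* u + \<Gamma> v, S v)\<close>: coordinates \<open>(True, i, A)\<close> carry \<open>u\<close> and \<open>(False, i, A)\<close>
  carry \<open>v\<close>; \<open>S\<close> is the nilpotent shift in \<open>i < N\<close> and \<open>\<Gamma>\<close> the Hankel matrix of \<open>foguel_symbol\<close>.\<close>

definition foguel_symbol :: "real \<Rightarrow> nat \<Rightarrow> (nat \<Rightarrow> nat \<Rightarrow> nat \<Rightarrow> real) \<Rightarrow> nat \<Rightarrow> nat \<Rightarrow> nat \<Rightarrow> complex" where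
  "foguel_symbol \<delta> N w k A B = (if k < N then of_real (beta \<delta> k * w k A B) else 0)"

definition foguel_block :: "real \<Rightarrow> nat \<Rightarrow> nat \<Rightarrow> (nat \<Rightarrow> nat \<Rightarrow> nat \<Rightarrow> real) \<Rightarrow>
    (bool \<times> nat \<times> nat \<Rightarrow> complex) \<Rightarrow> bool \<times> nat \<times> nat \<Rightarrow> complex" where
  "foguel_block \<delta> N d w x = (\<lambda>(s, i, A). if i < N \<and> A < d then
      (if s then (if Suc i < N then x (True, Suc i, A) else 0) +
        (\<Sum>j<N. \<Sum>B<d. foguel_symbol \<delta> N w (i + j) A B * x (False, j, B))
       else if i = 0 then 0 else x (False, i - 1, A))
    else 0)"

definition block_index :: "nat \<Rightarrow> nat \<Rightarrow> (bool \<times> nat \<times> nat) set" where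
  "block_index N d = UNIV \<times> {..<N} \<times> {..<d}"

lemma finite_block_index [simp]: "finite (block_index N d)"
  by (simp add: block_index_def)

lemma sum_block_index:
  "(\<Sum>s\<in>block_index N d. f s) = (\<Sum>A<d. \<Sum>i<N. f (True, i, A)) + (\<Sum>A<d. \<Sum>i<N. f (False, i, A))"
proof -
  have "(\<Sum>s\<in>block_index N d. f s) = (\<Sum>b\<in>UNIV. \<Sum>i<N. \<Sum>A<d. f (b, i, A))"
    unfolding block_index_def by (simp add: sum.cartesian_product case_prod_unfold)
  then show ?thesis by (simp add: UNIV_bool sum.swap[of _ "{..<d}"] sum.distrib add.commute)
qed

text \<open>\<Gamma> S^n is again a Hankel matrix, with its symbol moved by n; what the truncation
  of the shift cuts off is zero because the symbol vanishes from \<open>N\<close> on.\<close>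

lemma foguel_symbol_shift:
  "(\<Sum>j<N. \<Sum>B<d. foguel_symbol \<delta> N w (i + j) A B * (if j < n then 0 else x (j - n) B)) =
   (\<Sum>j<N. \<Sum>B<d. foguel_symbol \<delta> N w (i + j + n) A B * x j B)"
proof -
  let ?g = "foguel_symbol \<delta> N w"
  have "(\<Sum>j<N. \<Sum>B<d. ?g (i + j) A B * (if j < n then 0 else x (j - n) B)) =
      (\<Sum>j\<in>{n..<N}. \<Sum>B<d. ?g (i + j) A B * x (j - n) B)"
    by (intro sum.mono_neutral_cong_right) auto
  also have "\<dots> = (\<Sum>j\<in>{0..<N - n}. \<Sum>B<d. ?g (i + j + n) A B * x j B)"
    unfolding sum.atLeastLessThan_shift_0[of _ n] by (simp add: add_ac)
  also have "\<dots> = (\<Sum>j<N. \<Sum>B<d. ?g (i + j + n) A B * x j B)"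
    by (intro sum.mono_neutral_left) (auto simp: foguel_symbol_def intro!: sum.neutral)
  finally show ?thesis .
qed

text \<open>By the intertwining of \<Gamma> with the shift and its adjoint, the n products in the
  corner of the n-th power all equal \<Gamma> S^(n-1). This factor n is what produces the derivative
  of P. At n = 0 the same factor makes the truncated subtraction harmless.\<close>

lemma foguel_block_power:
  assumes x: "\<forall>s. s \<notin> block_index N d \<longrightarrow> x s = 0"
  shows "(foguel_block \<delta> N d w ^^ n) x = (\<lambda>(s, i, A). if i < N \<and> A < d then
      (if s then x (True, i + n, A) +
        of_nat n * (\<Sum>j<N. \<Sum>B<d. foguel_symbol \<delta> N w (i + j + n - 1) A B * x (False, j, B))
       else if i < n then 0 else x (False, i - n, A))
    else 0)"
proof (induction n)
  case 0
  show ?case using x by (auto simp: fun_eq_iff block_index_def)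
next
  case (Suc n)
  let ?g = "foguel_symbol \<delta> N w"
  have top: "(if Suc i < N then x (True, Suc i + n, A) +
        of_nat n * (\<Sum>j<N. \<Sum>B<d. ?g (Suc i + j + n - 1) A B * x (False, j, B)) else 0) +
      (\<Sum>j<N. \<Sum>B<d. ?g (i + j) A B * (if j < n then 0 else x (False, j - n, B))) =
      x (True, i + Suc n, A) + of_nat (Suc n) * (\<Sum>j<N. \<Sum>B<d. ?g (i + j + Suc n - 1) A B * x (False, j, B))"
    if "i < N" for i A
  proof -
    \<comment> \<open>In the last row the cut-off of the backward shift discards only terms that
      vanish anyway.\<close>
    have "x (True, i + Suc n, A) = 0" "?g (i + j + n) A B = 0 \<or> n = 0" if "\<not> Suc i < N" for j B
      using that \<open>i < N\<close> by (auto simp: x block_index_def foguel_symbol_def)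
    then show ?thesis
      unfolding foguel_symbol_shift[where x = "\<lambda>j B. x (False, j, B)"]
      by (cases "n = 0") (auto simp: algebra_simps)
  qed
  have "(foguel_block \<delta> N d w ^^ Suc n) x = foguel_block \<delta> N d w ((foguel_block \<delta> N d w ^^ n) x)"
    by simp
  also have "\<dots> = (\<lambda>(s, i, A). if i < N \<and> A < d then
      (if s then x (True, i + Suc n, A) +
        of_nat (Suc n) * (\<Sum>j<N. \<Sum>B<d. ?g (i + j + Suc n - 1) A B * x (False, j, B))
       else if i < Suc n then 0 else x (False, i - Suc n, A))
    else 0)"
    unfolding Suc.IH
  proof (rule ext, clarify)
    fix s i A
    show "foguel_block \<delta> N d w (\<lambda>(s, i, A). if i < N \<and> A < d then
      (if s then x (True, i + n, A) +
        of_nat n * (\<Sum>j<N. \<Sum>B<d. ?g (i + j + n - 1) A B * x (False, j, B))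
       else if i < n then 0 else x (False, i - n, A)) else 0) (s, i, A) =
      (if i < N \<and> A < d then
      (if s then x (True, i + Suc n, A) +
        of_nat (Suc n) * (\<Sum>j<N. \<Sum>B<d. ?g (i + j + Suc n - 1) A B * x (False, j, B))
       else if i < Suc n then 0 else x (False, i - Suc n, A))
      else 0)"
    proof (cases "i < N \<and> A < d \<and> s")
      case True
      then show ?thesis
        unfolding top[symmetric, of i A, OF conjunct1[OF True]] by (simp add: foguel_block_def)
    next
      case False
      then show ?thesis
        by (auto simp: foguel_block_def)
    qed
  qed
  finally show ?case .
qed

section \<open>Norm of a polynomial in one block\<close>

lemma sum_cmod_add_square_le:
  assumes a: "(\<Sum>s\<in>S. (cmod (a s))\<^sup>2) \<le> \<alpha>\<^sup>2 * X" and b: "(\<Sum>s\<in>S. (cmod (b s))\<^sup>2) \<le> \<gamma>\<^sup>2 * X"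
    and nonneg: "0 \<le> \<alpha>" "0 \<le> \<gamma>" "0 \<le> X"
  shows "(\<Sum>s\<in>S. (cmod (a s + b s))\<^sup>2) \<le> (\<alpha> + \<gamma>)\<^sup>2 * X"
proof -
  have 1: "L2_set (\<lambda>s. cmod (a s)) S \<le> \<alpha> * sqrt X" "L2_set (\<lambda>s. cmod (b s)) S \<le> \<gamma> * sqrt X"
    using real_sqrt_le_mono[OF a] real_sqrt_le_mono[OF b] nonneg
    by (simp_all add: L2_set_def real_sqrt_mult)
  have "L2_set (\<lambda>s. cmod (a s + b s)) S \<le> L2_set (\<lambda>s. cmod (a s) + cmod (b s)) S"
    by (intro L2_set_mono norm_triangle_ineq) auto
  also have "\<dots> \<le> L2_set (\<lambda>s. cmod (a s)) S + L2_set (\<lambda>s. cmod (b s)) S"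
    by (rule L2_set_triangle_ineq)
  also have "\<dots> \<le> (\<alpha> + \<gamma>) * sqrt X"
    using 1 by (simp add: distrib_right)
  finally have "(L2_set (\<lambda>s. cmod (a s + b s)) S)\<^sup>2 \<le> ((\<alpha> + \<gamma>) * sqrt X)\<^sup>2"
    by (intro power_mono) auto
  then show ?thesis
    using nonneg by (simp add: L2_set_def sum_nonneg power_mult_distrib)
qed

text \<open>Von Neumann's inequality for the nilpotent shift, which is multiplication by z on
  truncated polynomials.\<close>

lemma toeplitz_le:
  "(\<Sum>i<N. (cmod (\<Sum>n\<le>degree P. coeff P n * (if i < n then 0 else y (i - n))))\<^sup>2) \<le>
    (poly_sup_norm P)\<^sup>2 * (\<Sum>i<N. (cmod (y i))\<^sup>2)"
proof -
  define Y where "Y = (\<Sum>i<N. monom (y i) i)"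
  have Y: "coeff Y n = (if n < N then y n else 0)" for n
    unfolding Y_def by (rule coeff_sum_monom)
  have "(\<Sum>n\<le>degree P. coeff P n * (if i < n then 0 else y (i - n))) = coeff (P * Y) i" if "i < N" for i
  proof -
    have "(\<Sum>n\<le>degree P. coeff P n * (if i < n then 0 else y (i - n))) =
      (\<Sum>n\<le>degree P + i. coeff P n * (if i < n then 0 else y (i - n)))"
      by (intro sum.mono_neutral_left) (auto simp: coeff_eq_0)
    also have "\<dots> = (\<Sum>n\<le>i. coeff P n * coeff Y (i - n))"
      using that by (intro sum.mono_neutral_cong_right) (auto simp: Y)
    finally show ?thesis by (simp add: coeff_mult)
  qed
  then have "(\<Sum>i<N. (cmod (\<Sum>n\<le>degree P. coeff P n * (if i < n then 0 else y (i - n))))\<^sup>2) =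
    (\<Sum>i<N. (cmod (coeff (P * Y) i))\<^sup>2)"
    by simp
  also have "\<dots> \<le> (poly_sup_norm P)\<^sup>2 * (\<Sum>i<N. (cmod (coeff Y i))\<^sup>2)"
    by (rule sum_coeff_mult_le)
  finally show ?thesis by (simp add: Y)
qed

text \<open>Reversing the coordinates, \<open>i\<close> to \<open>N - Suc i\<close>, carries the
  backward shift to the forward one.\<close>

lemma toeplitz_adjoint_le:
  assumes y: "\<And>i. i \<ge> N \<Longrightarrow> y i = 0"
  shows "(\<Sum>i<N. (cmod (\<Sum>n\<le>degree P. coeff P n * y (i + n)))\<^sup>2) \<le>
    (poly_sup_norm P)\<^sup>2 * (\<Sum>i<N. (cmod (y i))\<^sup>2)"
proof -
  have e: "y (N - Suc i + n) = (if i < n then 0 else y (N - Suc (i - n)))" if "i < N" for i n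
    using that y by (auto intro: arg_cong[of _ _ y])
  have "(\<Sum>i<N. (cmod (\<Sum>n\<le>degree P. coeff P n * y (i + n)))\<^sup>2) =
    (\<Sum>i<N. (cmod (\<Sum>n\<le>degree P. coeff P n * y (N - Suc i + n)))\<^sup>2)"
    by (rule sum.nat_diff_reindex[symmetric])
  also have "\<dots> = (\<Sum>i<N. (cmod (\<Sum>n\<le>degree P. coeff P n * (if i < n then 0 else y (N - Suc (i - n)))))\<^sup>2)"
    by (intro sum.cong refl) (simp only: e lessThan_iff)
  also have "\<dots> \<le> (poly_sup_norm P)\<^sup>2 * (\<Sum>i<N. (cmod (y (N - Suc i)))\<^sup>2)"
    by (rule toeplitz_le)
  also have "(\<Sum>i<N. (cmod (y (N - Suc i)))\<^sup>2) = (\<Sum>i<N. (cmod (y i))\<^sup>2)"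
    by (rule sum.nat_diff_reindex)
  finally show ?thesis .
qed

lemma sum_pderiv_shift:
  fixes g :: "nat \<Rightarrow> complex"
  assumes g: "\<And>k. k \<ge> N \<Longrightarrow> g k = 0"
  shows "(\<Sum>n\<le>degree P. coeff P n * (of_nat n * g (r + n - 1))) =
    (\<Sum>k<N. (if r \<le> k then coeff (pderiv P) (k - r) else 0) * g k)"
proof -
  define M where "M = degree P + N"
  have "(\<Sum>n\<le>degree P. coeff P n * (of_nat n * g (r + n - 1))) =
    (\<Sum>n<Suc M. coeff P n * (of_nat n * g (r + n - 1)))"
    by (intro sum.mono_neutral_left) (auto simp: coeff_eq_0 M_def)
  also have "\<dots> = (\<Sum>m<M. coeff (pderiv P) m * g (r + m))"
    unfolding sum.lessThan_Suc_shift by (simp add: coeff_pderiv mult_ac)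
  also have "\<dots> = (\<Sum>m\<in>{0..<N - r}. coeff (pderiv P) m * g (r + m))"
    by (intro sum.mono_neutral_right) (auto simp: M_def intro!: g)
  also have "\<dots> = (\<Sum>k\<in>{r..<N}. coeff (pderiv P) (k - r) * g k)"
    unfolding sum.atLeastLessThan_shift_0[of _ r] by simp
  also have "\<dots> = (\<Sum>k<N. (if r \<le> k then coeff (pderiv P) (k - r) else 0) * g k)"
    by (intro sum.mono_neutral_cong_left) auto
  finally show ?thesis .
qed

text \<open>\<open>D\<close> is the diagonal of the polynomial, bounded by the sup norm, and
  \<open>H\<close> is its corner \<Gamma> P'(S). The corner has squared norm at most 2 * 4 *
  \<delta>^2 times that of P: the 2 comes from the symmetries, the 4 from the derivative estimate,
  and 8 is rounded up to 9 to give 3 \<delta>.\<close>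

lemma foguel_block_poly_le:
  assumes w: "anticommuting N d w" and \<delta>: "0 \<le> \<delta>"
    and x: "\<forall>s. s \<notin> block_index N d \<longrightarrow> x s = 0"
  shows "(\<Sum>s\<in>block_index N d. (cmod (\<Sum>n\<le>degree P. coeff P n * (foguel_block \<delta> N d w ^^ n) x s))\<^sup>2) \<le>
    ((1 + 3 * \<delta>) * poly_sup_norm P)\<^sup>2 * (\<Sum>s\<in>block_index N d. (cmod (x s))\<^sup>2)"
proof -
  let ?p = "poly_sup_norm P"
  let ?X = "\<Sum>s\<in>block_index N d. (cmod (x s))\<^sup>2"
  let ?g = "foguel_symbol \<delta> N w"
  define D :: "bool \<times> nat \<times> nat \<Rightarrow> complex" where "D = (\<lambda>(s, i, A).
    if s then \<Sum>n\<le>degree P. coeff P n * x (True, i + n, A)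
    else \<Sum>n\<le>degree P. coeff P n * (if i < n then 0 else x (False, i - n, A)))"
  define H :: "bool \<times> nat \<times> nat \<Rightarrow> complex" where "H = (\<lambda>(s, i, A).
    if s then \<Sum>b<N. \<Sum>k<N. \<Sum>B<d. of_real (w k A B) * (derivative_symbol \<delta> N P (i + b) k * x (False, b, B))
    else 0)"
  have "(\<Sum>n\<le>degree P. coeff P n * (foguel_block \<delta> N d w ^^ n) x s) = D s + H s"
    if s: "s \<in> block_index N d" for s
  proof -
    obtain t i A where s': "s = (t, i, A)" "i < N" "A < d"
      using s by (auto simp: block_index_def)
    have "(\<Sum>n\<le>degree P. coeff P n * (of_nat n * (\<Sum>j<N. \<Sum>B<d. ?g (i + j + n - 1) A B * x (False, j, B)))) =
      (\<Sum>j<N. \<Sum>B<d. (\<Sum>n\<le>degree P. coeff P n * (of_nat n * ?g (i + j + n - 1) A B)) * x (False, j, B))"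
    proof -
      have "(\<Sum>n\<le>degree P. coeff P n * (of_nat n * (\<Sum>j<N. \<Sum>B<d. ?g (i + j + n - 1) A B * x (False, j, B)))) =
        (\<Sum>n\<le>degree P. \<Sum>j<N. \<Sum>B<d. coeff P n * (of_nat n * ?g (i + j + n - 1) A B) * x (False, j, B))"
        by (simp add: sum_distrib_left mult_ac)
      also have "\<dots> = (\<Sum>j<N. \<Sum>B<d. \<Sum>n\<le>degree P. coeff P n * (of_nat n * ?g (i + j + n - 1) A B) * x (False, j, B))"
        by (simp only: sum.swap[of _ _ "{..degree P}"])
      finally show ?thesis by (simp only: sum_distrib_right)
    qed
    also have "\<dots> = (\<Sum>j<N. \<Sum>B<d. (\<Sum>k<N. (if i + j \<le> k then coeff (pderiv P) (k - (i + j)) else 0) * ?g k A B) * x (False, j, B))"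
      by (intro sum.cong refl arg_cong2[of _ _ _ _ times] sum_pderiv_shift) (simp add: foguel_symbol_def)
    also have "\<dots> = (\<Sum>j<N. \<Sum>B<d. \<Sum>k<N. of_real (w k A B) * (derivative_symbol \<delta> N P (i + j) k * x (False, j, B)))"
      unfolding sum_distrib_right
      by (intro sum.cong refl) (auto simp: derivative_symbol_def foguel_symbol_def)
    also have "\<dots> = (\<Sum>j<N. \<Sum>k<N. \<Sum>B<d. of_real (w k A B) * (derivative_symbol \<delta> N P (i + j) k * x (False, j, B)))"
      by (rule sum.cong[OF refl], rule sum.swap)
    finally have "(\<Sum>n\<le>degree P. coeff P n * (of_nat n * (\<Sum>j<N. \<Sum>B<d. ?g (i + j + n - 1) A B * x (False, j, B)))) =
      H (True, i, A)"
      by (simp add: H_def)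
    then show ?thesis
      unfolding foguel_block_power[OF x] s'(1) using s'
      by (cases t) (simp_all add: D_def distrib_left sum.distrib H_def)
  qed
  then have "(\<Sum>s\<in>block_index N d. (cmod (\<Sum>n\<le>degree P. coeff P n * (foguel_block \<delta> N d w ^^ n) x s))\<^sup>2) =
    (\<Sum>s\<in>block_index N d. (cmod (D s + H s))\<^sup>2)"
    by simp
  also have "\<dots> \<le> (?p + 3 * \<delta> * ?p)\<^sup>2 * ?X"
  proof (rule sum_cmod_add_square_le)
    have x0: "x (True, i, A) = 0" if "i \<ge> N" for i A
      using that x by (auto simp: block_index_def)
    show "(\<Sum>s\<in>block_index N d. (cmod (D s))\<^sup>2) \<le> ?p\<^sup>2 * ?X"
      unfolding sum_block_index D_def prod.case if_True if_False simp_thms distrib_left sum_distrib_left[of _ _ "{..<d}"]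
      by (intro add_mono sum_mono toeplitz_le toeplitz_adjoint_le[of _ "\<lambda>i. x (True, i, _)"] x0)
    have "(\<Sum>s\<in>block_index N d. (cmod (H s))\<^sup>2) = (\<Sum>A<d. \<Sum>i<N. (cmod (\<Sum>b<N. \<Sum>k<N. \<Sum>B<d.
        of_real (w k A B) * (derivative_symbol \<delta> N P (i + b) k * x (False, b, B))))\<^sup>2)"
      unfolding sum_block_index H_def by simp
    also have "\<dots> \<le> 2 * (4 * \<delta>\<^sup>2 * ?p\<^sup>2) * (\<Sum>B<d. \<Sum>b<N. (cmod (x (False, b, B)))\<^sup>2)"
      by (rule hankel_clifford_le[OF hankel_le_derivative_symbol _ _ w, where v = "\<lambda>b B. x (False, b, B)"])
        (auto simp: derivative_symbol_def)
    also have "\<dots> \<le> (3 * \<delta> * ?p)\<^sup>2 * ?X"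
    proof (rule mult_mono)
      show "2 * (4 * \<delta>\<^sup>2 * ?p\<^sup>2) \<le> (3 * \<delta> * ?p)\<^sup>2"
        by (simp add: power_mult_distrib)
    qed (auto simp: sum_block_index intro!: sum_nonneg)
    finally show "(\<Sum>s\<in>block_index N d. (cmod (H s))\<^sup>2) \<le> (3 * \<delta> * ?p)\<^sup>2 * ?X" .
  qed (use \<delta> in \<open>auto simp: poly_sup_norm_nonneg intro!: sum_nonneg\<close>)
  finally show ?thesis by (simp add: algebra_simps)
qed

subsection \<open>Direct sums of finite blocks\<close>

lemma norm_ell2_square: "(norm x)\<^sup>2 = (\<Sum>n. (cmod (coord x n))\<^sup>2)"
  using coord[of x] by (simp add: norm_ell2.rep_eq suminf_nonneg)

lemma summable_coord: "summable (\<lambda>n. (cmod (coord x n))\<^sup>2)"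
  using coord[of x] by simp

lemma coord_sum: "coord (\<Sum>i\<in>I. f i) n = (\<Sum>i\<in>I. coord (f i) n)"
  by (induction I rule: infinite_finite_induct) (simp_all add: zero_ell2.rep_eq plus_ell2.rep_eq)

lemma coord_scaleR: "coord (r *\<^sub>R x) n = of_real r * coord x n"
  by (simp add: scaleR_ell2_def scale_ell2.rep_eq)

lemma cmod_coord_le_norm: "cmod (coord x n) \<le> norm x"
proof -
  have "(\<Sum>k\<in>{n}. (cmod (coord x k))\<^sup>2) \<le> (\<Sum>n. (cmod (coord x n))\<^sup>2)"
    by (rule sum_le_suminf[OF summable_coord]) auto
  then have "(cmod (coord x n))\<^sup>2 \<le> (norm x)\<^sup>2" by (simp add: norm_ell2_square)
  then show ?thesis by (rule power2_le_imp_le) simp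
qed

lemma ell2_eqI: "(\<And>n. coord x n = coord y n) \<Longrightarrow> x = y"
  by (metis coord_inject ext)

text \<open>The bijection \<open>e\<close> labels the coordinates of \<open>ell2\<close> by the
  basis vectors of all blocks, so the direct sum acts on \<open>ell2\<close> itself. One constant
  \<open>C\<close> serves every block and every polynomial; the polynomial X gives boundedness of
  the sum.\<close>

locale ell2_direct_sum =
  fixes V :: "nat \<Rightarrow> 'b set" and \<tau> :: "nat \<Rightarrow> ('b \<Rightarrow> complex) \<Rightarrow> 'b \<Rightarrow> complex"
    and C :: real and e :: "nat \<Rightarrow> nat \<times> 'b"
  assumes finite_V: "finite (V m)"
    and e: "bij_betw e UNIV (SIGMA m:UNIV. V m)"
    and \<tau>_add: "\<tau> m (\<lambda>s. x s + y s) = (\<lambda>s. \<tau> m x s + \<tau> m y s)"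
    and \<tau>_scale: "\<tau> m (\<lambda>s. c * x s) = (\<lambda>s. c * \<tau> m x s)"
    and \<tau>_outside: "s \<notin> V m \<Longrightarrow> \<tau> m x s = 0"
    and \<tau>_poly_le: "\<forall>s. s \<notin> V m \<longrightarrow> x s = 0 \<Longrightarrow>
      (\<Sum>s\<in>V m. (cmod (\<Sum>n\<le>degree P. coeff P n * (\<tau> m ^^ n) x s))\<^sup>2) \<le>
      (C * poly_sup_norm P)\<^sup>2 * (\<Sum>s\<in>V m. (cmod (x s))\<^sup>2)"
    and C_nonneg: "0 \<le> C"
begin

definition e' :: "nat \<times> 'b \<Rightarrow> nat" where "e' = inv_into UNIV e"

lemma e'_e: "e' (e n) = n"
  using e by (simp add: e'_def bij_betw_def)

lemma e_e': "s \<in> V m \<Longrightarrow> e (e' (m, s)) = (m, s)"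
  using e by (auto simp: e'_def bij_betw_def intro!: f_inv_into_f)

lemma e_in: "snd (e n) \<in> V (fst (e n))"
proof -
  have "e n \<in> (SIGMA m:UNIV. V m)" using e by (auto simp: bij_betw_def)
  then show ?thesis by auto
qed

definition slice :: "nat \<Rightarrow> ell2 \<Rightarrow> 'b \<Rightarrow> complex" where
  "slice m x s = (if s \<in> V m then coord x (e' (m, s)) else 0)"

lemma slice_outside: "\<forall>s. s \<notin> V m \<longrightarrow> slice m x s = 0"
  by (simp add: slice_def)

lemma sum_slice_le_norm: "(\<Sum>m<M. \<Sum>s\<in>V m. (cmod (slice m x s))\<^sup>2) \<le> (norm x)\<^sup>2"
proof -
  have "inj_on e' (SIGMA m:{..<M}. V m)"
    by (rule inj_on_inverseI[of _ e]) (auto simp: e_e')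
  then have "(\<Sum>m<M. \<Sum>s\<in>V m. (cmod (slice m x s))\<^sup>2) =
    (\<Sum>n\<in>e' ` (SIGMA m:{..<M}. V m). (cmod (coord x n))\<^sup>2)"
    by (simp add: sum.Sigma finite_V sum.reindex slice_def case_prod_unfold)
  also have "\<dots> \<le> (norm x)\<^sup>2"
    unfolding norm_ell2_square by (rule sum_le_suminf[OF summable_coord]) (auto simp: finite_V)
  finally show ?thesis .
qed

text \<open>Every initial segment of coordinates lies in finitely many blocks, so a bound uniform in
  the number of blocks controls all partial sums.\<close>

lemma square_summable_of_blocks:
  fixes c :: "nat \<Rightarrow> complex"
  assumes B: "\<And>M. (\<Sum>m<M. \<Sum>s\<in>V m. (cmod (c (e' (m, s))))\<^sup>2) \<le> B"
  shows "summable (\<lambda>n. (cmod (c n))\<^sup>2)" "(\<Sum>n. (cmod (c n))\<^sup>2) \<le> B"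
proof -
  have *: "(\<Sum>n<N. (cmod (c n))\<^sup>2) \<le> B" for N
  proof -
    define M where "M = Suc (Max ((fst \<circ> e) ` {..<N}))"
    have "fst (e n) < M" if "n < N" for n
      unfolding M_def using that by (intro le_imp_less_Suc Max_ge) auto
    then have sub: "e ` {..<N} \<subseteq> (SIGMA m:{..<M}. V m)"
      using e_in by (auto simp: mem_Sigma_iff) (metis e_in fst_conv snd_conv)+
    have "inj_on e {..<N}" by (rule inj_on_inverseI[of _ e']) (simp add: e'_e)
    then have "(\<Sum>n<N. (cmod (c n))\<^sup>2) = (\<Sum>p\<in>e ` {..<N}. (cmod (c (e' p)))\<^sup>2)"
      by (simp add: sum.reindex e'_e)
    also have "\<dots> \<le> (\<Sum>p\<in>(SIGMA m:{..<M}. V m). (cmod (c (e' p)))\<^sup>2)"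
      by (intro sum_mono2 sub) (auto simp: finite_V)
    also have "\<dots> = (\<Sum>m<M. \<Sum>s\<in>V m. (cmod (c (e' (m, s))))\<^sup>2)"
      by (simp add: sum.Sigma finite_V case_prod_unfold)
    also have "\<dots> \<le> B" by (rule B)
    finally show ?thesis .
  qed
  show "summable (\<lambda>n. (cmod (c n))\<^sup>2)"
    by (rule summableI_nonneg_bounded[OF _ *]) simp
  then show "(\<Sum>n. (cmod (c n))\<^sup>2) \<le> B"
    by (rule suminf_le_const) (rule *)
qed

definition T_coord :: "ell2 \<Rightarrow> nat \<Rightarrow> complex" where
  "T_coord x n = \<tau> (fst (e n)) (slice (fst (e n)) x) (snd (e n))"

text \<open>\<open>Abs_ell2\<close> returns the prescribed coordinates only for square-summable
  ones, which \<open>coord_T\<close> derives from the block bound.\<close>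

definition T :: "ell2 \<Rightarrow> ell2" where
  "T x = Abs_ell2 (T_coord x)"

definition emb :: "nat \<Rightarrow> ('b \<Rightarrow> complex) \<Rightarrow> ell2" where
  "emb m y = Abs_ell2 (\<lambda>n. if fst (e n) = m then y (snd (e n)) else 0)"

lemma poly_sup_norm_X: "poly_sup_norm [:0, 1:] = 1"
proof -
  have "(\<lambda>z. cmod (poly [:0, 1:] z)) ` {z. cmod z = 1} = {1}"
    by (auto simp: image_iff intro!: exI[of _ 1])
  then show ?thesis by (simp add: poly_sup_norm_def)
qed

lemma \<tau>_le:
  assumes "\<forall>s. s \<notin> V m \<longrightarrow> x s = 0"
  shows "(\<Sum>s\<in>V m. (cmod (\<tau> m x s))\<^sup>2) \<le> C\<^sup>2 * (\<Sum>s\<in>V m. (cmod (x s))\<^sup>2)"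
  using \<tau>_poly_le[OF assms, of "[:0, 1:]"] unfolding poly_sup_norm_X by simp

lemma coord_T: "coord (T x) n = T_coord x n"
proof -
  have "(\<Sum>m<M. \<Sum>s\<in>V m. (cmod (T_coord x (e' (m, s))))\<^sup>2) \<le> C\<^sup>2 * (norm x)\<^sup>2" for M
  proof -
    have "(\<Sum>m<M. \<Sum>s\<in>V m. (cmod (T_coord x (e' (m, s))))\<^sup>2) =
      (\<Sum>m<M. \<Sum>s\<in>V m. (cmod (\<tau> m (slice m x) s))\<^sup>2)"
      by (simp add: T_coord_def e_e')
    also have "\<dots> \<le> (\<Sum>m<M. C\<^sup>2 * (\<Sum>s\<in>V m. (cmod (slice m x s))\<^sup>2))"
      by (intro sum_mono \<tau>_le slice_outside)
    also have "\<dots> \<le> C\<^sup>2 * (norm x)\<^sup>2"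
      unfolding sum_distrib_left[symmetric] by (intro mult_left_mono sum_slice_le_norm) auto
    finally show ?thesis .
  qed
  from square_summable_of_blocks(1)[OF this] show ?thesis
    unfolding T_def by (subst Abs_ell2_inverse) auto
qed

lemma slice_T: "slice m (T x) = \<tau> m (slice m x)"
  by (auto simp: fun_eq_iff slice_def[of m "T x"] coord_T T_coord_def e_e' \<tau>_outside)

lemma slice_T_power: "slice m ((T ^^ n) x) = (\<tau> m ^^ n) (slice m x)"
  by (induction n) (simp_all add: slice_T)

lemma slice_add: "slice m (x + y) = (\<lambda>s. slice m x s + slice m y s)"
  by (auto simp: fun_eq_iff slice_def plus_ell2.rep_eq)

lemma slice_scale: "slice m (c *\<^sub>C x) = (\<lambda>s. c * slice m x s)"
  by (auto simp: fun_eq_iff slice_def scale_ell2.rep_eq)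

lemma poly_operator_le: "norm (poly_operator P T x) \<le> C * poly_sup_norm P * norm x"
proof -
  let ?y = "poly_operator P T x"
  have y: "slice m ?y s = (\<Sum>n\<le>degree P. coeff P n * (\<tau> m ^^ n) (slice m x) s)" if "s \<in> V m" for m s
    using that unfolding poly_operator_def slice_T_power[symmetric]
    by (simp add: slice_def coord_sum scale_ell2.rep_eq)
  have "(\<Sum>m<M. \<Sum>s\<in>V m. (cmod (coord ?y (e' (m, s))))\<^sup>2) \<le> (C * poly_sup_norm P)\<^sup>2 * (norm x)\<^sup>2" for M
  proof -
    have "(\<Sum>m<M. \<Sum>s\<in>V m. (cmod (coord ?y (e' (m, s))))\<^sup>2) = (\<Sum>m<M. \<Sum>s\<in>V m. (cmod (slice m ?y s))\<^sup>2)"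
      by (simp add: slice_def)
    also have "\<dots> \<le> (\<Sum>m<M. (C * poly_sup_norm P)\<^sup>2 * (\<Sum>s\<in>V m. (cmod (slice m x s))\<^sup>2))"
    proof (rule sum_mono)
      fix m
      show "(\<Sum>s\<in>V m. (cmod (slice m ?y s))\<^sup>2) \<le> (C * poly_sup_norm P)\<^sup>2 * (\<Sum>s\<in>V m. (cmod (slice m x s))\<^sup>2)"
        using \<tau>_poly_le[OF slice_outside[of m x], where P = P] by (simp add: y)
    qed
    also have "\<dots> \<le> (C * poly_sup_norm P)\<^sup>2 * (norm x)\<^sup>2"
      unfolding sum_distrib_left[symmetric] by (intro mult_left_mono sum_slice_le_norm) auto
    finally show ?thesis .
  qed
  from square_summable_of_blocks(2)[OF this]
  have "(norm ?y)\<^sup>2 \<le> (C * poly_sup_norm P * norm x)\<^sup>2"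
    by (simp add: norm_ell2_square[symmetric] power_mult_distrib)
  then show ?thesis
    by (rule power2_le_imp_le) (simp add: C_nonneg poly_sup_norm_nonneg)
qed

lemma onorm_poly_operator_le: "onorm (poly_operator P T) \<le> C * poly_sup_norm P"
  by (rule onorm_bound) (use poly_operator_le C_nonneg poly_sup_norm_nonneg in auto)

lemma T_scale: "T (c *\<^sub>C x) = c *\<^sub>C T x"
  by (rule ell2_eqI) (simp add: coord_T T_coord_def scale_ell2.rep_eq slice_scale \<tau>_scale)

lemma bounded_operator_T: "bounded_operator T"
  unfolding bounded_operator_def
proof (intro conjI allI)
  show "bounded_linear T"
  proof (rule bounded_linear_intro)
    show "T (x + y) = T x + T y" for x y
      by (rule ell2_eqI) (simp add: coord_T T_coord_def plus_ell2.rep_eq slice_add \<tau>_add)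
    show "T (r *\<^sub>R x) = r *\<^sub>R T x" for r x
      by (simp add: scaleR_ell2_def T_scale)
    show "norm (T x) \<le> norm x * C" for x
    proof -
      have "poly_operator [:0, 1:] T x = T x"
        by (rule ell2_eqI) (simp add: poly_operator_def plus_ell2.rep_eq scale_ell2.rep_eq)
      then show ?thesis
        using poly_operator_le[of "[:0, 1:]" x] by (simp add: poly_sup_norm_X mult.commute)
    qed
  qed
qed (rule T_scale)

lemma emb:
  assumes "\<forall>s. s \<notin> V m \<longrightarrow> y s = 0"
  shows coord_emb: "coord (emb m y) n = (if fst (e n) = m then y (snd (e n)) else 0)"
    and norm_emb_le: "(norm (emb m y))\<^sup>2 \<le> (\<Sum>s\<in>V m. (cmod (y s))\<^sup>2)"
proof -
  let ?c = "\<lambda>n. if fst (e n) = m then y (snd (e n)) else 0"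
  have "(\<Sum>k<M. \<Sum>s\<in>V k. (cmod (?c (e' (k, s))))\<^sup>2) \<le> (\<Sum>s\<in>V m. (cmod (y s))\<^sup>2)" for M
  proof -
    have "(\<Sum>k<M. \<Sum>s\<in>V k. (cmod (?c (e' (k, s))))\<^sup>2) = (\<Sum>k<M. if k = m then \<Sum>s\<in>V k. (cmod (y s))\<^sup>2 else 0)"
      by (intro sum.cong refl) (auto simp: e_e' intro!: sum.neutral)
    also have "\<dots> \<le> (\<Sum>s\<in>V m. (cmod (y s))\<^sup>2)"
      by (simp add: sum.delta sum_nonneg)
    finally show ?thesis .
  qed
  note * = square_summable_of_blocks[OF this]
  show c: "coord (emb m y) n = ?c n" for n
    unfolding emb_def using *(1) by (subst Abs_ell2_inverse) auto
  show "(norm (emb m y))\<^sup>2 \<le> (\<Sum>s\<in>V m. (cmod (y s))\<^sup>2)"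
    unfolding norm_ell2_square c by (rule *(2))
qed

lemma T_emb:
  assumes "\<forall>s. s \<notin> V m \<longrightarrow> y s = 0"
  shows "T (emb m y) = emb m (\<tau> m y)"
proof (rule ell2_eqI)
  fix n
  have 0: "\<tau> k (\<lambda>s. 0) = (\<lambda>s. 0)" for k
    using \<tau>_scale[of k 0 "\<lambda>_. 0"] by simp
  have "slice k (emb m y) = (if k = m then y else (\<lambda>s. 0))" for k
    using assms by (auto simp: fun_eq_iff slice_def coord_emb e_e')
  then show "coord (T (emb m y)) n = coord (emb m (\<tau> m y)) n"
    by (simp add: coord_T T_coord_def coord_emb \<tau>_outside 0)
qed

lemma T_power_emb:
  assumes "\<forall>s. s \<notin> V m \<longrightarrow> y s = 0"
  shows "(T ^^ n) (emb m y) = emb m ((\<tau> m ^^ n) y) \<and> (\<forall>s. s \<notin> V m \<longrightarrow> (\<tau> m ^^ n) y s = 0)"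
  by (induction n) (use assms in \<open>auto simp: T_emb \<tau>_outside\<close>)

end

subsection \<open>Similarity to a contraction\<close>

text \<open>The real part of the complex inner product. A real form is enough here, since the
  symmetries and the weights \<open>a\<close> are real.\<close>

definition ell2_inner :: "ell2 \<Rightarrow> ell2 \<Rightarrow> real" where
  "ell2_inner x y = (\<Sum>n. inner (coord x n) (coord y n))"

lemma summable_ell2_inner: "summable (\<lambda>n. inner (coord x n) (coord y n))"
proof (rule summable_comparison_test)
  show "summable (\<lambda>n. (cmod (coord x n))\<^sup>2 + (cmod (coord y n))\<^sup>2)"
    by (intro summable_add summable_coord)
  have "norm (inner (coord x n) (coord y n)) \<le> (cmod (coord x n))\<^sup>2 + (cmod (coord y n))\<^sup>2" for n
  proof -
    have "norm (inner (coord x n) (coord y n)) \<le> cmod (coord x n) * cmod (coord y n)"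
      using Cauchy_Schwarz_ineq2 by simp
    also have "\<dots> \<le> (cmod (coord x n))\<^sup>2 + (cmod (coord y n))\<^sup>2"
      using sum_squares_bound[of "cmod (coord x n)" "cmod (coord y n)"]
        mult_nonneg_nonneg[OF norm_ge_zero[of "coord x n"] norm_ge_zero[of "coord y n"]] by linarith
    finally show ?thesis .
  qed
  then show "\<exists>N. \<forall>n\<ge>N. norm (inner (coord x n) (coord y n)) \<le> (cmod (coord x n))\<^sup>2 + (cmod (coord y n))\<^sup>2"
    by blast
qed

lemma bilinear_ell2_inner: "bilinear ell2_inner"
proof -
  have sym: "ell2_inner x y = ell2_inner y x" for x y
    by (simp add: ell2_inner_def inner_commute)
  have lin: "linear (\<lambda>x. ell2_inner x y)" for y
  proof (rule linearI)
    show "ell2_inner (a + b) y = ell2_inner a y + ell2_inner b y" for a b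
      unfolding ell2_inner_def
      by (simp add: plus_ell2.rep_eq inner_add_left suminf_add summable_ell2_inner)
    show "ell2_inner (r *\<^sub>R a) y = r *\<^sub>R ell2_inner a y" for r a
    proof -
      have "inner (coord (r *\<^sub>R a) n) (coord y n) = r * inner (coord a n) (coord y n)" for n
        by (simp add: scaleR_ell2_def scale_ell2.rep_eq flip: scaleR_conv_of_real)
      then show ?thesis
        by (simp add: ell2_inner_def suminf_mult summable_ell2_inner)
    qed
  qed
  show ?thesis
    unfolding bilinear_def
  proof (intro conjI allI)
    fix x
    have "ell2_inner x = (\<lambda>y. ell2_inner y x)" by (rule ext) (rule sym)
    then show "linear (ell2_inner x)" using lin[of x] by simp
  qed (rule lin)
qed

lemma ell2_inner_self: "ell2_inner x x = (norm x)\<^sup>2"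
  using coord[of x] by (simp add: ell2_inner_def norm_ell2.rep_eq dot_square_norm suminf_nonneg)

text \<open>A nilpotent contraction \<open>A\<close> is a part of a direct sum of backward shifts: its defect form
  \<open>Q x x = \<parallel>x\<parallel>\<^sup>2 - \<parallel>A x\<parallel>\<^sup>2\<close> is positive and \<open>\<parallel>x\<parallel>\<^sup>2\<close> is the sum of \<open>Q\<close> over the orbit of \<open>x\<close>. So only
  polynomials in the shift need to be bounded, and there the anticommutation relations apply.\<close>

lemma nilpotent_contraction_clifford_le:
  fixes A :: "'v::real_normed_vector \<Rightarrow> 'v" and a :: "nat \<Rightarrow> real"
    and ip :: "'v \<Rightarrow> 'v \<Rightarrow> real"
  assumes ip: "bilinear ip" "\<And>x. ip x x = (norm x)\<^sup>2"
    and A: "linear A" "\<And>x. norm (A x) \<le> norm x"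
    and nil: "\<And>B. B < d \<Longrightarrow> (A ^^ L) (\<xi> B) = 0"
    and w: "anticommuting K d w"
  defines "y \<equiv> \<lambda>b. \<Sum>k<K. \<Sum>B<d. w k b B *\<^sub>R (a k *\<^sub>R (A ^^ Suc k) (\<xi> B))"
  shows "(\<Sum>b<d. (norm (y b))\<^sup>2) \<le> 2 * (\<Sum>k<K. (a k)\<^sup>2) * (\<Sum>B<d. (norm (\<xi> B))\<^sup>2)"
proof -
  define Q where "Q x y = ip x y - ip (A x) (A y)" for x y
  have Q: "bilinear Q"
  proof -
    have l: "linear (ip x)" "linear (\<lambda>x. ip x y)" for x y
      using ip(1) unfolding bilinear_def by auto
    have "linear (\<lambda>y. ip x y - ip (A x) (A y))" "linear (\<lambda>x. ip x y - ip (A x) (A y))" for x y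
      using linear_compose_sub[OF l(1) linear_compose[OF A(1) l(1)]]
        linear_compose_sub[OF l(2) linear_compose[OF A(1) l(2)]]
      by (simp_all add: o_def)
    then show ?thesis unfolding Q_def bilinear_def by blast
  qed
  have Q0: "Q x 0 = 0" "Q 0 x = 0" for x
    using Q by (auto simp: bilinear_lzero bilinear_rzero)
  have Qs: "Q (r *\<^sub>R x) (s *\<^sub>R x') = r * s * Q x x'" for r s x x'
    using Q by (simp add: bilinear_lmul bilinear_rmul)
  have Q_nonneg: "0 \<le> Q x x" for x
    using A(2)[of x] by (simp add: Q_def ip power_mono)
  have telescope: "(\<Sum>m<n. Q ((A ^^ m) x) ((A ^^ m) x)) = (norm x)\<^sup>2 - (norm ((A ^^ n) x))\<^sup>2" for n x
    by (induction n) (simp_all add: Q_def ip)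
  have linp: "linear (A ^^ n)" for n
  proof (induction n)
    case (Suc n)
    then show ?case using linear_compose[OF Suc A(1)] by (simp add: o_def)
  qed (simp add: linear_ident)
  have nil': "(A ^^ n) (\<xi> B) = 0" if "B < d" "L \<le> n" for n B
  proof -
    have "(A ^^ n) (\<xi> B) = (A ^^ (n - L)) ((A ^^ L) (\<xi> B))"
      using that(2) funpow_add[of "n - L" L A] by simp
    then show ?thesis using that nil linear_0[OF linp] by simp
  qed
  \<comment> \<open>Extending the orbit by zero to the integers allows it to be shifted in both
    directions.\<close>
  define u where "u B n = (if n < 0 then 0 else (A ^^ nat n) (\<xi> B))" for B and n :: int
  have u0: "u B n = 0" if "B < d" "n \<notin> {0..<int L}" for B n
  proof (cases "n < 0")
    case False
    then have "L \<le> nat n" using that(2) by auto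
    then show ?thesis using nil'[OF that(1)] False by (simp add: u_def)
  qed (simp add: u_def)
  \<comment> \<open>The shifts below add up to at most \<open>2 * K\<close>, so the window holds the
    supports of all Gram terms both before and after translation.\<close>
  define Z where "Z = int L + 2 * int K + 2"
  define S where "S = {- Z..Z}"
  \<comment> \<open>The direction of the shift plays the role of conjugation in the scalar case:
    reversing it exchanges k and l in the Gram matrix.\<close>
  define v where "v k B n = a k *\<^sub>R u B (n + int (Suc k))" for k B n
  define v' where "v' k B n = a k *\<^sub>R u B (n - int (Suc k))" for k B n
  define z where "z b n = (\<Sum>k<K. \<Sum>B<d. w k b B *\<^sub>R v k B n)" for b n
  define z' where "z' b n = (\<Sum>k<K. \<Sum>B<d. w k b B *\<^sub>R v' k B n)" for b n
  have *: "(\<Sum>n\<in>S. \<Sum>b<d. Q (z b n) (z b n)) + (\<Sum>n\<in>S. \<Sum>b<d. Q (z' b n) (z' b n)) =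
    2 * (\<Sum>k<K. \<Sum>B<d. \<Sum>n\<in>S. Q (v k B n) (v k B n))"
    unfolding z_def z'_def
  proof (rule clifford_parallelogram[OF Q w])
    fix k l B C assume kl: "k < K" "l < K" and BC: "B < d" "C < d"
    \<comment> \<open>Both Gram entries are \<open>a k * a l\<close> times a sum of
      \<open>f\<close>, one of them translated by \<open>t\<close>; translation does not change the
      sum, as \<open>f\<close> is supported well inside the window.\<close>
    define f where "f n = Q (u B (n + int (Suc l))) (u C (n + int (Suc k)))" for n
    define t where "t = int (Suc k) + int (Suc l)"
    have f0: "f n = 0" if "n \<notin> {- int K..int L}" for n
    proof -
      have "n + int (Suc l) \<notin> {0..<int L}" using that kl by auto
      show ?thesis unfolding f_def u0[OF BC(1) \<open>n + int (Suc l) \<notin> {0..<int L}\<close>] Q0 ..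
    qed
    have "(\<Sum>n\<in>S. f (n - t)) = (\<Sum>n\<in>(\<lambda>n. n - t) ` S. f n)"
      by (simp add: sum.reindex inj_on_def)
    also have "\<dots> = (\<Sum>n\<in>{- int K..int L}. f n)"
    proof (rule sum.mono_neutral_right)
      show "{- int K..int L} \<subseteq> (\<lambda>n. n - t) ` S"
      proof
        fix n assume "n \<in> {- int K..int L}"
        then have "n + t \<in> S" using kl by (auto simp: S_def Z_def t_def)
        then show "n \<in> (\<lambda>n. n - t) ` S" by (rule rev_image_eqI) simp
      qed
    next
      show "finite ((\<lambda>n. n - t) ` S)" by (simp add: S_def)
      show "\<forall>n\<in>(\<lambda>n. n - t) ` S - {- int K..int L}. f n = 0" using f0 by blast
    qed
    also have "\<dots> = (\<Sum>n\<in>S. f n)"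
    proof (rule sum.mono_neutral_left)
      show "finite S" by (simp add: S_def)
      show "{- int K..int L} \<subseteq> S" by (auto simp: S_def Z_def)
      show "\<forall>n\<in>S - {- int K..int L}. f n = 0" using f0 by blast
    qed
    finally have "(\<Sum>n\<in>S. f (n - t)) = (\<Sum>n\<in>S. f n)" .
    moreover have "Q (v' k B n) (v' l C n) = a k * a l * f (n - t)" for n
    proof -
      have "n - t + int (Suc l) = n - int (Suc k)" "n - t + int (Suc k) = n - int (Suc l)"
        by (simp_all add: t_def)
      then show ?thesis by (simp only: v'_def Qs f_def)
    qed
    moreover have "Q (v l B n) (v k C n) = a k * a l * f n" for n
      by (simp only: v_def f_def Qs mult.commute)
    ultimately show "(\<Sum>n\<in>S. Q (v' k B n) (v' l C n)) = (\<Sum>n\<in>S. Q (v l B n) (v k C n))"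
      by (simp add: sum_distrib_left[symmetric])
  qed
  have main: "(\<Sum>n\<in>S. \<Sum>b<d. Q (z b n) (z b n)) \<le> 2 * (\<Sum>k<K. \<Sum>B<d. \<Sum>n\<in>S. Q (v k B n) (v k B n))"
  proof -
    have "0 \<le> (\<Sum>n\<in>S. \<Sum>b<d. Q (z' b n) (z' b n))" by (intro sum_nonneg Q_nonneg)
    then show ?thesis using * by linarith
  qed
  have z: "z b (int m) = (A ^^ m) (y b)" for b m
  proof -
    have "u B (int m + int (Suc k)) = (A ^^ m) ((A ^^ Suc k) (\<xi> B))" for B k
    proof -
      have e: "nat (int m + int (Suc k)) = m + Suc k" by simp
      show ?thesis unfolding u_def e funpow_add by simp
    qed
    then show ?thesis
      by (simp add: z_def v_def y_def linear_sum[OF linp] linear_cmul[OF linp] del: funpow.simps of_nat_Suc)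
  qed
  have y_nil: "(A ^^ L) (y b) = 0" for b
  proof -
    have "(A ^^ L) ((A ^^ Suc k) (\<xi> B)) = 0" if "B < d" for k B
      using nil'[OF that, of "L + Suc k"] unfolding funpow_add by simp
    then show ?thesis
      unfolding y_def linear_sum[OF linp] linear_cmul[OF linp]
      by (intro sum.neutral ballI) (simp del: funpow.simps)
  qed
  \<comment> \<open>Nilpotency removes the last term of the telescoping sum, so the squared norm is
    the full sum of the defect form; positivity then permits enlarging the range to the
    window.\<close>
  have "(\<Sum>b<d. (norm (y b))\<^sup>2) = (\<Sum>b<d. \<Sum>m<L. Q (z b (int m)) (z b (int m)))"
    unfolding z telescope y_nil by simp
  also have "\<dots> = (\<Sum>m<L. \<Sum>b<d. Q (z b (int m)) (z b (int m)))"
    by (rule sum.swap)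
  also have "\<dots> = (\<Sum>n\<in>int ` {..<L}. \<Sum>b<d. Q (z b n) (z b n))"
    by (simp add: sum.reindex)
  also have "\<dots> \<le> (\<Sum>n\<in>S. \<Sum>b<d. Q (z b n) (z b n))"
    by (intro sum_mono2) (auto simp: S_def Z_def intro!: sum_nonneg Q_nonneg)
  also have "\<dots> \<le> 2 * (\<Sum>k<K. \<Sum>B<d. \<Sum>n\<in>S. Q (v k B n) (v k B n))"
    by (rule main)
  also have "\<dots> \<le> 2 * (\<Sum>k<K. \<Sum>B<d. (a k)\<^sup>2 * (norm (\<xi> B))\<^sup>2)"
  proof (intro mult_left_mono sum_mono)
    fix k B assume "B \<in> {..<d}"
    then have B: "B < d" by simp
    define h where "h n = Q (u B n) (u B n)" for n
    have h0: "h n = 0" if "n \<notin> {0..<int L}" for n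
      using u0[OF B that] by (simp add: h_def Q0)
    have h_nonneg: "0 \<le> h n" for n by (simp add: h_def Q_nonneg)
    have "(\<Sum>n\<in>S. h (n + int (Suc k))) = (\<Sum>n\<in>(\<lambda>n. n + int (Suc k)) ` S. h n)"
      by (simp add: sum.reindex inj_on_def)
    also have "\<dots> = (\<Sum>n\<in>(\<lambda>n. n + int (Suc k)) ` S \<inter> {0..<int L}. h n)"
      by (rule sum.mono_neutral_right) (use h0 in \<open>auto simp: S_def\<close>)
    also have "\<dots> \<le> (\<Sum>n\<in>{0..<int L}. h n)"
      by (intro sum_mono2) (auto simp: h_nonneg)
    also have "{0..<int L} = int ` {..<L}"
      by (simp add: image_int_atLeastLessThan lessThan_atLeast0)
    also have "(\<Sum>n\<in>int ` {..<L}. h n) = (\<Sum>m<L. Q ((A ^^ m) (\<xi> B)) ((A ^^ m) (\<xi> B)))"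
      by (simp add: sum.reindex h_def u_def)
    also have "\<dots> \<le> (norm (\<xi> B))\<^sup>2"
      unfolding telescope by simp
    finally have "(\<Sum>n\<in>S. h (n + int (Suc k))) \<le> (norm (\<xi> B))\<^sup>2" .
    moreover have "(\<Sum>n\<in>S. Q (v k B n) (v k B n)) = (a k)\<^sup>2 * (\<Sum>n\<in>S. h (n + int (Suc k)))"
      by (simp add: v_def Qs h_def sum_distrib_left power2_eq_square del: of_nat_Suc)
    ultimately show "(\<Sum>n\<in>S. Q (v k B n) (v k B n)) \<le> (a k)\<^sup>2 * (norm (\<xi> B))\<^sup>2"
      by (simp add: mult_left_mono)
  qed simp
  also have "\<dots> = 2 * (\<Sum>k<K. (a k)\<^sup>2) * (\<Sum>B<d. (norm (\<xi> B))\<^sup>2)"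
    by (simp add: sum_product)
  finally show ?thesis .
qed

section \<open>Harmonic divergence of the weighted coefficients\<close>

text \<open>The right side is \<delta>^2 times 1 - ((k + 1) / (k + 2))^2 = (2 k + 3) / (k +
  2)^2.\<close>

lemma beta_weighted_square_ge: "\<delta>\<^sup>2 * (1 / real (Suc (Suc k))) \<le> (real (Suc k) * beta \<delta> k)\<^sup>2"
proof -
  have "1 / real (Suc (Suc k)) \<le> (real k + 1)\<^sup>2 * (1 / (real k + 1)\<^sup>2 - 1 / (real (Suc k) + 1)\<^sup>2)"
    by (simp add: divide_simps) (simp add: power2_eq_square algebra_simps)
  then have "\<delta>\<^sup>2 * (1 / real (Suc (Suc k))) \<le> \<delta>\<^sup>2 * \<dots>"
    by (rule mult_left_mono) simp
  also have "\<dots> = (real (Suc k) * beta \<delta> k)\<^sup>2"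
    unfolding power_mult_distrib beta_square by (simp add: mult.left_commute add.commute)
  finally show ?thesis .
qed

lemma sum_beta_weighted_unbounded:
  assumes "0 < \<delta>"
  shows "\<exists>N. B < (\<Sum>k<Suc N. (real (Suc k) * beta \<delta> k)\<^sup>2)"
proof (rule ccontr)
  assume "\<nexists>N. B < (\<Sum>k<Suc N. (real (Suc k) * beta \<delta> k)\<^sup>2)"
  then have "(\<Sum>k<Suc N. (real (Suc k) * beta \<delta> k)\<^sup>2) \<le> B" for N
    by (simp add: not_less)
  moreover have "(\<Sum>k<N. (real (Suc k) * beta \<delta> k)\<^sup>2) \<le> (\<Sum>k<Suc N. (real (Suc k) * beta \<delta> k)\<^sup>2)" for N
    by simp
  ultimately have le: "(\<Sum>k<N. (real (Suc k) * beta \<delta> k)\<^sup>2) \<le> B" for N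
    by (rule order_trans[rotated])
  have "summable (\<lambda>k. \<delta>\<^sup>2 * (1 / real (Suc (Suc k))))"
  proof (rule summableI_nonneg_bounded)
    show "(\<Sum>k<N. \<delta>\<^sup>2 * (1 / real (Suc (Suc k)))) \<le> B" for N
      using sum_mono[OF beta_weighted_square_ge] le by (rule order_trans)
  qed simp
  then have "summable (\<lambda>k. 1 / real (Suc (Suc k)))"
    using assms by (subst (asm) summable_cmult_iff) simp
  then have "summable (\<lambda>k. 1 / real k)"
    by (subst (asm) summable_Suc_iff[of "\<lambda>k. 1 / real (Suc k)"]) (simp only: summable_Suc_iff[of "\<lambda>k. 1 / real k"])
  then show False
    using not_summable_harmonic[where 'a = real] by (simp add: inverse_eq_divide)
qed

locale foguel_direct_sum =
  fixes \<delta> :: real and d :: "nat \<Rightarrow> nat" and w :: "nat \<Rightarrow> nat \<Rightarrow> nat \<Rightarrow> nat \<Rightarrow> real"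
    and e :: "nat \<Rightarrow> nat \<times> bool \<times> nat \<times> nat"
  assumes \<delta>: "0 < \<delta>" and d: "0 < d m" and w: "anticommuting (Suc m) (d m) (w m)"
    and e: "bij_betw e UNIV (SIGMA m:UNIV. block_index (Suc m) (d m))"
begin

sublocale ell2_direct_sum "\<lambda>m. block_index (Suc m) (d m)"
  "\<lambda>m. foguel_block \<delta> (Suc m) (d m) (w m)" "1 + 3 * \<delta>" e
proof
  show "foguel_block \<delta> (Suc m) (d m) (w m) (\<lambda>s. x s + y s) =
    (\<lambda>s. foguel_block \<delta> (Suc m) (d m) (w m) x s + foguel_block \<delta> (Suc m) (d m) (w m) y s)" for m x y
    by (auto simp: foguel_block_def fun_eq_iff distrib_left sum.distrib)
  show "foguel_block \<delta> (Suc m) (d m) (w m) (\<lambda>s. c * x s) =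
    (\<lambda>s. c * foguel_block \<delta> (Suc m) (d m) (w m) x s)" for m c x
    by (auto simp: foguel_block_def fun_eq_iff distrib_left sum_distrib_left mult_ac)
  show "foguel_block \<delta> (Suc m) (d m) (w m) x s = 0" if "s \<notin> block_index (Suc m) (d m)" for s m x
    using that by (auto simp: foguel_block_def block_index_def split: prod.splits)
qed (use \<delta> e in \<open>auto intro!: foguel_block_poly_le w\<close>)

text \<open>Each of the \<open>d m\<close> vectors \<open>y b\<close> has norm at least \<sigma>
  divided by the norm of \<open>S\<close>, while their squares together are at most 2 \<sigma> times
  \<open>d m\<close> times the squared norm of \<open>inv S\<close>. The dimension and one factor
  \<sigma> cancel, leaving a bound that is independent of \<open>m\<close>.\<close>

lemma similarity_bound:
  assumes S: "invertible_operator S" and contr: "onorm (inv S \<circ> T \<circ> S) \<le> 1"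
  shows "(\<Sum>k<Suc m. (real (Suc k) * beta \<delta> k)\<^sup>2) \<le> 2 * (onorm S * onorm (inv S))\<^sup>2"
proof -
  have blS: "bounded_linear S" and blS': "bounded_linear (inv S)" and bij: "bij S"
    using S by (auto simp: invertible_operator_def bounded_operator_def)
  have blT: "bounded_linear T" using bounded_operator_T by (simp add: bounded_operator_def)
  have S_inv: "S (inv S x) = x" for x
    using bij by (simp add: bij_is_surj surj_f_inv_f)
  define A where "A = inv S \<circ> T \<circ> S"
  have blA: "bounded_linear A"
    unfolding A_def comp_def
    by (intro bounded_linear_compose[OF blS'] bounded_linear_compose[OF blT] blS)
  have A_le: "norm (A x) \<le> norm x" for x
  proof -
    have "norm (A x) \<le> onorm A * norm x" by (rule onorm[OF blA])
    also have "\<dots> \<le> 1 * norm x" using contr by (intro mult_right_mono) (auto simp: A_def)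
    finally show ?thesis by simp
  qed
  have A_pow: "(A ^^ n) (inv S x) = inv S ((T ^^ n) x)" for n x
    by (induction n) (simp_all add: A_def S_inv)
  let ?N = "Suc m" and ?d = "d m" and ?w = "w m"
  let ?\<tau> = "foguel_block \<delta> ?N ?d ?w"
  define x :: "nat \<Rightarrow> bool \<times> nat \<times> nat \<Rightarrow> complex" where
    "x B = (\<lambda>s. if s = (False, 0, B) then 1 else 0)" for B
  have x_out: "\<forall>s. s \<notin> block_index ?N ?d \<longrightarrow> x B s = 0" if "B < ?d" for B
    using that by (auto simp: x_def block_index_def)
  define \<xi> where "\<xi> B = inv S (emb m (x B))" for B
  \<comment> \<open>The exponent is one more than the block size because the corner of the power
    \<open>?N\<close> still reads the last nonzero entry of the symbol, at index
    \<open>?N - 1\<close>.\<close>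
  have \<tau>_nil: "(?\<tau> ^^ Suc ?N) (x B) = (\<lambda>s. 0)" if "B < ?d" for B
    unfolding foguel_block_power[OF x_out[OF that]]
    by (auto simp: fun_eq_iff x_def foguel_symbol_def)
  have nil: "(A ^^ Suc ?N) (\<xi> B) = 0" if "B < ?d" for B
  proof -
    have "(T ^^ Suc ?N) (emb m (x B)) = emb m (\<lambda>s. 0)"
      using T_power_emb[OF x_out[OF that], of "Suc ?N"] unfolding \<tau>_nil[OF that] by blast
    also have "\<dots> = 0"
      by (rule ell2_eqI) (simp add: coord_emb zero_ell2.rep_eq)
    finally show ?thesis
      unfolding \<xi>_def A_pow by (simp add: linear_simps(3)[OF blS'])
  qed
  \<comment> \<open>With this choice the sum of the squares of \<open>a\<close> coincides with its
    pairing against \<open>(k + 1) * beta \<delta> k\<close>, so the same \<sigma> appears in the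
    upper and the lower estimate.\<close>
  define a where "a k = real (Suc k) * beta \<delta> k" for k
  define y where "y b = (\<Sum>k<?N. \<Sum>B<?d. ?w k b B *\<^sub>R (a k *\<^sub>R (A ^^ Suc k) (\<xi> B)))" for b
  define \<sigma> where "\<sigma> = (\<Sum>k<?N. (a k)\<^sup>2)"
  have y_le: "(\<Sum>b<?d. (norm (y b))\<^sup>2) \<le> 2 * \<sigma> * (\<Sum>B<?d. (norm (\<xi> B))\<^sup>2)"
    unfolding y_def \<sigma>_def
    by (rule nilpotent_contraction_clifford_le[OF bilinear_ell2_inner ell2_inner_self
        bounded_linear.linear[OF blA] A_le nil w])
  have \<sigma>_le: "\<sigma> \<le> onorm S * norm (y b)" if b: "b < ?d" for b
  proof -
    have "S (y b) = (\<Sum>k<?N. \<Sum>B<?d. ?w k b B *\<^sub>R (a k *\<^sub>R (T ^^ Suc k) (emb m (x B))))"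
      unfolding y_def \<xi>_def A_pow
      by (simp only: linear_sum[OF bounded_linear.linear[OF blS]]
          linear_cmul[OF bounded_linear.linear[OF blS]] S_inv)
    also have "\<dots> = (\<Sum>k<?N. \<Sum>B<?d. ?w k b B *\<^sub>R (a k *\<^sub>R emb m ((?\<tau> ^^ Suc k) (x B))))"
    proof (intro sum.cong refl)
      fix k B assume "B \<in> {..<?d}"
      then have "(T ^^ Suc k) (emb m (x B)) = emb m ((?\<tau> ^^ Suc k) (x B))"
        using T_power_emb[OF x_out, of B "Suc k"] by blast
      then show "?w k b B *\<^sub>R (a k *\<^sub>R (T ^^ Suc k) (emb m (x B))) =
          ?w k b B *\<^sub>R (a k *\<^sub>R emb m ((?\<tau> ^^ Suc k) (x B)))"
        by (simp only:)
    qed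
    finally have Sy: "S (y b) = \<dots>" .
    have val: "coord (emb m ((?\<tau> ^^ Suc k) (x B))) (e' (m, (True, 0, b))) =
        of_real (real (Suc k) * beta \<delta> k * ?w k b B)" if "k < ?N" "B < ?d" for k B
    proof -
      have "coord (emb m ((?\<tau> ^^ Suc k) (x B))) (e' (m, (True, 0, b))) = (?\<tau> ^^ Suc k) (x B) (True, 0, b)"
        using T_power_emb[OF x_out[OF that(2)], of "Suc k"] b
        by (subst coord_emb) (auto simp: e_e' block_index_def)
      also have "\<dots> = of_nat (Suc k) * (\<Sum>j<?N. \<Sum>B'<?d. foguel_symbol \<delta> ?N ?w (j + k) b B' * x B (False, j, B'))"
        unfolding foguel_block_power[OF x_out[OF that(2)]] using b by (simp add: x_def)
      also have "(\<Sum>j<?N. \<Sum>B'<?d. foguel_symbol \<delta> ?N ?w (j + k) b B' * x B (False, j, B')) =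
          (\<Sum>j<?N. if j = 0 then foguel_symbol \<delta> ?N ?w k b B else 0)"
      proof (rule sum.cong[OF refl])
        fix j
        have "(\<Sum>B'<?d. foguel_symbol \<delta> ?N ?w (j + k) b B' * x B (False, j, B')) =
          (\<Sum>B'<?d. if B' = B then (if j = 0 then foguel_symbol \<delta> ?N ?w k b B else 0) else 0)"
          by (intro sum.cong refl) (auto simp: x_def)
        then show "(\<Sum>B'<?d. foguel_symbol \<delta> ?N ?w (j + k) b B' * x B (False, j, B')) =
          (if j = 0 then foguel_symbol \<delta> ?N ?w k b B else 0)"
          using that by simp
      qed
      also have "\<dots> = of_real (beta \<delta> k * ?w k b B)"
        using that by (simp add: foguel_symbol_def)
      finally show ?thesis by simp
    qed
    \<comment> \<open>The symmetry occurs once as a coefficient and once in the corner of the block,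
      so its entries are squared; each row has norm 1 and nothing cancels.\<close>
    have "coord (S (y b)) (e' (m, (True, 0, b))) =
        of_real (\<Sum>k<?N. \<Sum>B<?d. ?w k b B * (a k * (real (Suc k) * beta \<delta> k * ?w k b B)))"
      unfolding Sy coord_sum coord_scaleR of_real_sum of_real_mult[of "?w _ _ _"] of_real_mult[of "a _"]
      by (intro sum.cong refl arg_cong2[of _ _ _ _ times] val) auto
    also have "(\<Sum>k<?N. \<Sum>B<?d. ?w k b B * (a k * (real (Suc k) * beta \<delta> k * ?w k b B))) =
        (\<Sum>k<?N. (a k)\<^sup>2 * (\<Sum>B<?d. ?w k b B * ?w k b B))"
      by (simp add: a_def power2_eq_square sum_distrib_left mult_ac)
    also have "\<dots> = \<sigma>"
      unfolding \<sigma>_def by (intro sum.cong refl) (simp add: anticommuting_square[OF w] b)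
    finally have "\<sigma> \<le> cmod (coord (S (y b)) (e' (m, (True, 0, b))))" by simp
    also have "\<dots> \<le> norm (S (y b))" by (rule cmod_coord_le_norm)
    also have "\<dots> \<le> onorm S * norm (y b)" by (rule onorm[OF blS])
    finally show ?thesis .
  qed
  have \<xi>_le: "(norm (\<xi> B))\<^sup>2 \<le> (onorm (inv S))\<^sup>2" if "B < ?d" for B
  proof -
    have "(\<Sum>s\<in>block_index ?N ?d. (cmod (x B s))\<^sup>2) = (\<Sum>s\<in>block_index ?N ?d. if s = (False, 0, B) then 1 else 0)"
      by (intro sum.cong refl) (simp add: x_def)
    also have "\<dots> \<le> 1" by simp
    finally have "(norm (emb m (x B)))\<^sup>2 \<le> 1"
      using norm_emb_le[OF x_out[OF that]] by linarith
    then have "norm (emb m (x B)) \<le> 1" by (simp add: power_le_one_iff abs_square_le_1)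
    then have "onorm (inv S) * norm (emb m (x B)) \<le> onorm (inv S) * 1"
      by (intro mult_left_mono onorm_pos_le[OF blS'])
    then have "norm (\<xi> B) \<le> onorm (inv S)"
      using onorm[OF blS', of "emb m (x B)"] by (simp add: \<xi>_def)
    then show ?thesis by (intro power_mono) auto
  qed
  have \<sigma>_nonneg: "0 \<le> \<sigma>" by (simp add: \<sigma>_def sum_nonneg)
  have "real ?d * \<sigma>\<^sup>2 = (\<Sum>b<?d. \<sigma>\<^sup>2)" by simp
  also have "\<dots> \<le> (\<Sum>b<?d. (onorm S)\<^sup>2 * (norm (y b))\<^sup>2)"
    unfolding power_mult_distrib[symmetric] by (intro sum_mono power_mono \<sigma>_le \<sigma>_nonneg) auto
  also have "\<dots> = (onorm S)\<^sup>2 * (\<Sum>b<?d. (norm (y b))\<^sup>2)"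
    by (simp add: sum_distrib_left)
  also have "\<dots> \<le> (onorm S)\<^sup>2 * (2 * \<sigma> * (\<Sum>B<?d. (onorm (inv S))\<^sup>2))"
    by (intro mult_left_mono order_trans[OF y_le] sum_mono \<xi>_le) (auto simp: \<sigma>_nonneg)
  also have "\<dots> = real ?d * (\<sigma> * (2 * (onorm S * onorm (inv S))\<^sup>2))"
    by (simp add: power_mult_distrib)
  finally have "\<sigma> * \<sigma> \<le> \<sigma> * (2 * (onorm S * onorm (inv S))\<^sup>2)"
    using d[of m] by (simp add: power2_eq_square)
  then have "\<sigma> \<le> 2 * (onorm S * onorm (inv S))\<^sup>2"
    using \<sigma>_nonneg by (cases "\<sigma> = 0") auto
  then show ?thesis by (simp only: \<sigma>_def a_def)
qed

lemma not_similar_to_contraction: "\<not> similar_to_contraction T"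
proof
  assume "similar_to_contraction T"
  then obtain S where S: "invertible_operator S" "onorm (inv S \<circ> T \<circ> S) \<le> 1"
    unfolding similar_to_contraction_def by blast
  obtain m where "2 * (onorm S * onorm (inv S))\<^sup>2 < (\<Sum>k<Suc m. (real (Suc k) * beta \<delta> k)\<^sup>2)"
    using sum_beta_weighted_unbounded[OF \<delta>] by blast
  then show False using similarity_bound[OF S, of m] by simp
qed

end

section \<open>Choice of the symmetries, the enumeration and the weight\<close>

theorem mainTheorem1:
  shows "\<forall>\<epsilon>::real. \<epsilon> > 0 \<longrightarrow>
    (\<exists>T. bounded_operator T \<and>
      (\<forall>P. onorm (poly_operator P T) \<le> (1 + \<epsilon>) * poly_sup_norm P) \<and>
      \<not> similar_to_contraction T)"
proof (intro allI impI)
  fix \<epsilon> :: real assume \<epsilon>: "\<epsilon> > 0"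
  have "\<forall>m. \<exists>d w. 0 < d \<and> anticommuting (Suc m) d w"
    using anticommuting_exists by blast
  then obtain d w where dw: "\<And>m. 0 < d m" "\<And>m. anticommuting (Suc m) (d m) (w m)"
    by metis
  let ?I = "SIGMA m:UNIV. block_index (Suc m) (d m)"
  have "range (\<lambda>m. (m, (True, 0, 0))) \<subseteq> ?I"
    using dw(1) by (auto simp: block_index_def)
  moreover have "infinite (range (\<lambda>m::nat. (m, (True, 0::nat, 0::nat))))"
    by (rule range_inj_infinite) (simp add: inj_on_def)
  ultimately have "infinite ?I" by (rule infinite_super)
  then obtain e where "bij_betw e (UNIV :: nat set) ?I"
    using bij_betw_from_nat_into[of ?I] by auto
  \<comment> \<open>The polynomial bound of the direct sum has constant
    \<open>1 + 3 * \<delta>\<close>, hence the third of \<open>\<epsilon>\<close>.\<close>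
  then interpret foguel_direct_sum "\<epsilon> / 3" d w e
    using \<epsilon> dw by unfold_locales auto
  show "\<exists>T. bounded_operator T \<and>
      (\<forall>P. onorm (poly_operator P T) \<le> (1 + \<epsilon>) * poly_sup_norm P) \<and>
      \<not> similar_to_contraction T"
    using bounded_operator_T onorm_poly_operator_le not_similar_to_contraction
    by (intro exI[of _ T]) simp
qed

end
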